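(* Let $x^\dagger\in\operatorname{int}(\mathcal D(F))$, $y=F(x^\dagger)$, and suppose that for some $a>0$ and constants $0<c_a\le C_a<\infty$ $$c_a\|x-x^\dagger\|_{-a}\le\|F(x)-F(x^\dagger)\|_Y\le C_a\|x-x^\dagger\|_{-a}\qquad\text{for all }x\in\mathcal D=\mathcal D(F)\cap\mathcal D(B).$$ For data $y^\delta$ with $\|y-y^\delta\|_Y\le\delta$, let $x_\alpha^\delta$ be minimizers over $\mathcal D$ of the Tikhonov functional $T_\alpha^\delta$, and let the regularization parameter $\alpha_*=\max H_\delta$ be determined by the balancing principle described in the context. (1) If $x^\dagger-\overline x=B^{-p}w=G^{p/(2a+2)}w$ for some $w\in X$ and $0<p\le1$, where $G=B^{-(2a+2)}$, then $$\|x_{\alpha_*}^\delta-x^\dagger\|_X=\mathcal O\big(\delta^{\frac{p}{a+p}}\big)\quad\text{as }\delta\to0.$$ (2) If $x^\dagger-\overline x=\psi(G)w$ for some $w\in X$, where for some $\mu>0$, $K>0$ the function $\psi$ is given by $\psi(t)=K\log^{-\mu}(1/t)$ for $0<t\le e^{-1}$ and is continuously extended as a constant for $t>e^{-1}$, then $$\|x_{\alpha_*}^\delta-x^\dagger\|_X=\mathcal O\big(\log^{-\mu}(1/\delta)\big)\quad\text{as }\delta\to0.$$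
   Context: $X,Y$ are separable infinite-dimensional Hilbert spaces. $F:\mathcal D(F)\subseteq X\to Y$ is a (possibly nonlinear) weakly sequentially continuous operator whose domain $\mathcal D(F)$ is convex and closed in $X$. $B:\mathcal D(B)\subset X\to X$ is a densely defined, unbounded, self-adjoint linear operator with $\|Bx\|_X\ge\underline m\|x\|_X$ for all $x\in\mathcal D(B)$, for some $\underline m>0$. It generates the Hilbert scale $X_\tau=\mathcal D(B^\tau)$ for $\tau>0$, $X_\tau=X$ for $\tau\le0$, with $\|x\|_\tau:=\|B^\tau x\|_X$ for $\tau\in\mathbb R$. Functions of $G=B^{-(2a+2)}$ are defined by spectral calculus. Tikhonov functional: $T_\alpha^\delta(x):=\|F(x)-y^\delta\|_Y^2+\alpha\|B(x-\overline x)\|_X^2$ for $x\in\mathcal D:=\mathcal D(F)\cap\mathcal D(B)$, where $\overline x\in\mathcal D$ is a fixed initial guess. Balancing principle: put $\varkappa=\frac{a}{2a+2}$, $K_2=\max\{1,\frac{2}{c_a}\}$, $\lambda(\alpha)=\alpha^{\varkappa}/K_2$. For each noise level $0<\delta\le\delta_0$ let $\Delta_\delta=\{\alpha_0<\alpha_1<\dots<\alpha_N\}$ with $\alpha_j=q^j\alpha_0$, where $q>1$ is independent of $\delta$ while $\alpha_0$ and $N\ge0$ may depend on $\delta$, and $0<\alpha_0\le c_5\delta^{1/\varkappa}$, $c_6\le\alpha_N\le c_7$ with constants $c_5,c_6,c_7>0$ independent of $\delta$. Let $\tau_L>1+q^{-\varkappa}$ be fixed and $$H_\delta:=\Big\{\alpha_k\in\Delta_\delta:\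 \|x_{\alpha_j}^\delta-x_{\alpha_{j-1}}^\delta\|_X\le\tau_L\frac{\delta}{\lambda(\alpha_{j-1})}\ \text{ for all }1\le j\le k\Big\},\qquad\alpha_*=\max H_\delta.$$ *)

theory Defs
  imports
    "HOL-Analysis.Analysis"
    "HOL-Computational_Algebra.Polynomial"
    "HOL-Library.Landau_Symbols"
begin

definition infinite_dimensional :: "'a::real_vector itself \<Rightarrow> bool" where
  "infinite_dimensional _ \<longleftrightarrow> \<not> (\<exists>S::'a set. finite S \<and> span S = UNIV)"

definition weakly_tendsto :: "(nat \<Rightarrow> 'a::real_inner) \<Rightarrow> 'a \<Rightarrow> bool" where
  "weakly_tendsto u x \<longleftrightarrow> (\<forall>v. (\<lambda>n. inner (u n) v) \<longlonglongrightarrow> inner x v)"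

definition weakly_seq_continuous_on ::
  "'a::real_inner set \<Rightarrow> ('a \<Rightarrow> 'b::real_inner) \<Rightarrow> bool" where
  "weakly_seq_continuous_on S F \<longleftrightarrow>
     (\<forall>u x. (\<forall>n. u n \<in> S) \<and> x \<in> S \<and> weakly_tendsto u x \<longrightarrow> weakly_tendsto (\<lambda>n. F (u n)) (F x))"

text \<open>
  A partially defined operator is a pair of a domain \<open>D\<close> and a function \<open>B\<close> whose values
  outside \<open>D\<close> are irrelevant. The last conjunct of \<open>self_adjoint\<close> says that the
  graph of the adjoint, \<open>{(y, z). \<forall>x\<in>D. inner (B x) y = inner x z}\<close>, is the graph of \<open>B\<close>;
  in particular the domain of the adjoint is \<open>D\<close>.
\<close>

definition linear_operator_on :: "'a::real_vector set \<Rightarrow> ('a \<Rightarrow> 'a) \<Rightarrow> bool" where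
  "linear_operator_on D B \<longleftrightarrow> subspace D \<and>
     (\<forall>x\<in>D. \<forall>y\<in>D. B (x + y) = B x + B y) \<and> (\<forall>c. \<forall>x\<in>D. B (c *\<^sub>R x) = c *\<^sub>R B x)"

definition self_adjoint :: "'a::real_inner set \<Rightarrow> ('a \<Rightarrow> 'a) \<Rightarrow> bool" where
  "self_adjoint D B \<longleftrightarrow> linear_operator_on D B \<and> closure D = UNIV \<and>
     (\<forall>y z. (\<forall>x\<in>D. inner (B x) y = inner x z) \<longleftrightarrow> y \<in> D \<and> B y = z)"

definition unbounded_operator :: "'a::real_normed_vector set \<Rightarrow> ('a \<Rightarrow> 'a) \<Rightarrow> bool" where
  "unbounded_operator D B \<longleftrightarrow> \<not> (\<exists>C. \<forall>x\<in>D. norm (B x) \<le> C * norm x)"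

definition poly_of_operator ::
  "real poly \<Rightarrow> ('a::real_vector \<Rightarrow> 'a) \<Rightarrow> 'a \<Rightarrow> 'a" where
  "poly_of_operator p A x = (\<Sum>i\<le>degree p. coeff p i *\<^sub>R (A ^^ i) x)"

text \<open>
  Continuous spectral calculus of a bounded self-adjoint operator \<open>A\<close>: for \<open>f\<close> continuous on
  \<open>{-onorm A..onorm A}\<close>, an interval containing the spectrum, \<open>f(A)\<close> is the limit of \<open>p\<^sub>n(A)\<close>
  for any polynomials \<open>p\<^sub>n\<close> converging to \<open>f\<close> uniformly on that interval. Such polynomials exist
  by Weierstrass' theorem, and the limit exists and does not depend on their choice because
  the norm of \<open>p(A)\<close> is at most the supremum of \<open>\<bar>p\<bar>\<close> over the interval.
\<close>

definition spectral_calculus ::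
  "(real \<Rightarrow> real) \<Rightarrow> ('a::real_normed_vector \<Rightarrow> 'a) \<Rightarrow> 'a \<Rightarrow> 'a" where
  "spectral_calculus f A x =
     (THE y. \<forall>p :: nat \<Rightarrow> real poly.
        uniform_limit {- onorm A..onorm A} (\<lambda>n t. poly (p n) t) f sequentially \<longrightarrow>
        (\<lambda>n. poly_of_operator (p n) A x) \<longlonglongrightarrow> y)"

text \<open>
  For a self-adjoint \<open>B\<close> on \<open>D\<close> that is bounded below, \<open>inv_into D B\<close> is its everywhere defined
  bounded inverse. \<open>neg_power D B s\<close>, for \<open>s > 0\<close>, is the operator \<open>B\<^sup>-\<^sup>s\<close>, obtained by applying
  \<open>t \<mapsto> \<bar>t\<bar> powr s\<close> to this inverse. The absolute value plays no role when \<open>B\<close> is positive;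
  otherwise the powers are those of \<open>\<bar>B\<bar>\<close>, for which the norms of \<open>B x\<close> and \<open>\<bar>B\<bar> x\<close> agree.
\<close>

definition neg_power ::
  "'a::real_normed_vector set \<Rightarrow> ('a \<Rightarrow> 'a) \<Rightarrow> real \<Rightarrow> 'a \<Rightarrow> 'a" where
  "neg_power D B s = spectral_calculus (\<lambda>t. \<bar>t\<bar> powr s) (inv_into D B)"

definition neg_scale_norm ::
  "'a::real_normed_vector set \<Rightarrow> ('a \<Rightarrow> 'a) \<Rightarrow> real \<Rightarrow> 'a \<Rightarrow> real" where
  "neg_scale_norm D B a x = norm (neg_power D B a x)"

definition tikhonov ::
  "('a::real_normed_vector \<Rightarrow> 'b::real_normed_vector) \<Rightarrow> ('a \<Rightarrow> 'a) \<Rightarrow> 'a \<Rightarrow> 'b \<Rightarrow> real \<Rightarrow> 'a \<Rightarrow> real" where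
  "tikhonov F B xbar yd \<alpha> x = (norm (F x - yd))\<^sup>2 + \<alpha> * (norm (B (x - xbar)))\<^sup>2"

definition kap :: "real \<Rightarrow> real" where
  "kap a = a / (2 * a + 2)"

definition lam :: "real \<Rightarrow> real \<Rightarrow> real \<Rightarrow> real" where
  "lam a ca \<alpha> = \<alpha> powr kap a / max 1 (2 / ca)"

text \<open>
  \<open>balancing_set\<close> is the set \<open>H\<^sub>\<delta>\<close> for the grid \<open>\<alpha>\<^sub>j = q^j * \<alpha>\<^sub>0\<close>, \<open>j \<le> N\<close>, where \<open>x\<close> maps \<open>\<alpha>\<close> to the
  regularized solution \<open>x\<^sub>\<alpha>\<^sup>\<delta>\<close>. It is finite and contains \<open>\<alpha>\<^sub>0\<close>.
\<close>

definition balancing_set ::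
  "real \<Rightarrow> real \<Rightarrow> real \<Rightarrow> real \<Rightarrow> real \<Rightarrow> nat \<Rightarrow> (real \<Rightarrow> 'a::real_normed_vector) \<Rightarrow> real \<Rightarrow> real set" where
  "balancing_set a ca \<tau> q \<alpha>0 N x \<delta> =
     {q ^ k * \<alpha>0 | k. k \<le> N \<and>
        (\<forall>j\<in>{1..k}. norm (x (q ^ j * \<alpha>0) - x (q ^ (j - 1) * \<alpha>0))
                       \<le> \<tau> * (\<delta> / lam a ca (q ^ (j - 1) * \<alpha>0)))}"

definition balancing_param ::
  "real \<Rightarrow> real \<Rightarrow> real \<Rightarrow> real \<Rightarrow> real \<Rightarrow> nat \<Rightarrow> (real \<Rightarrow> 'a::real_normed_vector) \<Rightarrow> real \<Rightarrow> real" where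
  "balancing_param a ca \<tau> q \<alpha>0 N x \<delta> = Max (balancing_set a ca \<tau> q \<alpha>0 N x \<delta>)"

text \<open>
  The index function \<open>\<psi>\<close> of logarithmic type, equal to \<open>0\<close> on \<open>t \<le> 0\<close>, which is its continuous
  extension.
\<close>

definition log_index :: "real \<Rightarrow> real \<Rightarrow> real \<Rightarrow> real" where
  "log_index K \<mu> t =
     (if t \<le> 0 then 0 else if t \<le> exp (- 1) then K * ln (1 / t) powr (- \<mu>) else K)"

end

theory Submission
  imports Defs "HOL-Real_Asymp.Real_Asymp"
begin

text \<open>
  Let \<open>A = B\<^sup>-\<^sup>1\<close> and \<open>e = \<alpha> (G + \<alpha>)\<^sup>-\<^sup>1 (xdag - xbar)\<close>. The auxiliary element \<open>xdag - e\<close> minimizes the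
  linear model \<open>\<parallel>x - xdag\<parallel>\<^sub>-\<^sub>a\<^sup>2 + \<alpha> \<parallel>B (x - xbar)\<parallel>\<^sup>2\<close>, lies in \<open>DB\<close> even if \<open>xdag\<close> does not, and lies in
  \<open>DF\<close> for small \<open>\<alpha>\<close> because \<open>xdag\<close> is an interior point. Comparing the Tikhonov minimizer with it bounds
  their difference \<open>d\<close> in the norms of index \<open>-a\<close> and \<open>1\<close>, and interpolation gives the error bound
  \<open>\<delta> / \<lambda> \<alpha> + E * \<rho> \<alpha>\<close> whenever the source function is dominated by the index function \<open>\<rho>\<close>. The
  constant in front of \<open>\<delta> / \<lambda> \<alpha>\<close> has to be exactly \<open>1\<close>: then the slack \<open>\<tau>L - (1 + q powr (- \<kappa>))\<close> absorbs
  the approximation error as long as \<open>\<rho> \<alpha> * \<alpha> powr \<kappa> \<le> \<epsilon> * \<delta>\<close>, so that the balancing principle does not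
  stop before the largest such \<open>\<alpha>\<close>, and beyond it the increments form a geometric series.

  The spectral calculus rests on the positivity of \<open>p(A)\<close> for polynomials \<open>p\<close> that are nonnegative
  on \<open>{- onorm A..onorm A}\<close>, which needs no spectral theorem.
\<close>

section \<open>Continuous functional calculus of a symmetric operator\<close>

lemma poly_of_operator_extend:
  assumes "degree p \<le> n"
  shows "poly_of_operator p A x = (\<Sum>i\<le>n. coeff p i *\<^sub>R (A ^^ i) x)"
  unfolding poly_of_operator_def
  by (rule sum.mono_neutral_left) (use assms in \<open>auto simp: coeff_eq_0\<close>)

lemma poly_of_operator_0 [simp]: "poly_of_operator 0 A x = 0"
  by (simp add: poly_of_operator_def)

lemma poly_of_operator_add:
  "poly_of_operator (p + r) A x = poly_of_operator p A x + poly_of_operator r A x"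
proof -
  define n where "n = max (degree p) (degree r)"
  have "degree (p + r) \<le> n"
    by (simp add: n_def degree_add_le_max)
  then show ?thesis
    by (simp add: poly_of_operator_extend[where n = n] n_def scaleR_add_left sum.distrib)
qed

lemma poly_of_operator_smult:
  "poly_of_operator (smult c p) A x = c *\<^sub>R poly_of_operator p A x"
  by (simp add: poly_of_operator_extend[where n = "degree p"] scaleR_sum_right)

lemma poly_of_operator_minus:
  "poly_of_operator (- p) A x = - poly_of_operator p A x"
  using poly_of_operator_smult[of "-1" p A x] by simp

lemma poly_of_operator_diff:
  "poly_of_operator (p - r) A x = poly_of_operator p A x - poly_of_operator r A x"
  using poly_of_operator_add[of p "- r" A x] by (simp add: poly_of_operator_minus)

locale symmetric_operator =
  fixes A :: "'a::{real_inner, complete_space} \<Rightarrow> 'a"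
  assumes bounded_linear: "bounded_linear A"
    and symmetric: "inner (A x) y = inner x (A y)"
begin

abbreviation spec_interval :: "real set" where
  "spec_interval \<equiv> {- onorm A..onorm A}"

abbreviation P :: "real poly \<Rightarrow> 'a \<Rightarrow> 'a" where
  "P p \<equiv> poly_of_operator p A"

lemma linear_A: "linear A"
  using bounded_linear by (rule bounded_linear.linear)

lemma bounded_linear_funpow: "bounded_linear (A ^^ i)"
proof (induction i)
  case 0
  then show ?case by (simp add: id_def bounded_linear_ident)
next
  case (Suc i)
  then show ?case
    using bounded_linear_compose[OF bounded_linear Suc] by (simp add: comp_def)
qed

lemma bounded_linear_poly: "bounded_linear (P p)"
  unfolding poly_of_operator_def
  by (intro bounded_linear_sum bounded_linear_const_scaleR bounded_linear_funpow)

lemma linear_poly: "linear (P p)"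
  using bounded_linear_poly by (rule bounded_linear.linear)

text \<open>Horner's rule, the step of the inductions over the coefficients of a polynomial.\<close>

lemma P_pCons: "P (pCons c p) x = c *\<^sub>R x + A (P p x)"
proof -
  have "P (pCons c p) x = (\<Sum>i\<le>Suc (degree p). coeff (pCons c p) i *\<^sub>R (A ^^ i) x)"
    by (rule poly_of_operator_extend) (rule degree_pCons_le)
  also have "\<dots> = c *\<^sub>R x + (\<Sum>i\<le>degree p. coeff p i *\<^sub>R A ((A ^^ i) x))"
    by (subst sum.atMost_Suc_shift) simp
  also have "\<dots> = c *\<^sub>R x + A (P p x)"
    by (simp add: poly_of_operator_def linear_sum[OF linear_A] linear_cmul[OF linear_A])
  finally show ?thesis .
qed

lemma P_const: "P [:c:] x = c *\<^sub>R x"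
  by (simp add: P_pCons linear_0[OF linear_A])

lemma P_1: "P 1 x = x"
  using P_const[of 1 x] by (simp add: one_pCons)

lemma P_mult: "P (p * r) x = P p (P r x)"
proof (induction p)
  case 0
  then show ?case by simp
next
  case (pCons c p)
  then show ?case
    by (simp add: P_pCons poly_of_operator_add poly_of_operator_smult
        linear_0[OF linear_A])
qed

lemma poly_mult_commute: "P p (P r x) = P r (P p x)"
  by (metis P_mult mult.commute)

lemma poly_symmetric: "inner (P p x) y = inner x (P p y)"
proof (induction p arbitrary: x y)
  case 0
  then show ?case by simp
next
  case (pCons c p)
  have "P p (A y) = A (P p y)" for y
    using poly_mult_commute[of p "[:0, 1:]" y]
    by (simp add: P_pCons linear_0[OF linear_A])
  then show ?case
    by (simp add: P_pCons inner_add_left inner_add_right symmetric pCons.IH)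
qed

section \<open>Positivity of polynomials on the spectral interval\<close>

lemma onorm_nonneg: "0 \<le> onorm A"
  using bounded_linear by (rule onorm_pos_le)

lemma norm_le_onorm: "norm (A x) \<le> onorm A * norm x"
  using onorm[OF bounded_linear] by (simp add: mult.commute)

lemma abs_inner_le: "\<bar>inner (A x) x\<bar> \<le> onorm A * inner x x"
proof -
  have "\<bar>inner (A x) x\<bar> \<le> norm (A x) * norm x"
    by (rule Cauchy_Schwarz_ineq2)
  also have "\<dots> \<le> onorm A * norm x * norm x"
    by (intro mult_right_mono norm_le_onorm) simp
  finally show ?thesis
    by (simp add: power2_norm_eq_inner[symmetric] power2_eq_square mult.assoc)
qed

text \<open>By symmetry one factor \<open>s\<close> moves to the other argument, so a square in
  front of \<open>r\<close> preserves positivity of the quadratic form.\<close>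

lemma poly_square_weight: "inner (P (s * s * r) x) x = inner (P r (P s x)) (P s x)"
  by (metis P_mult poly_mult_commute poly_symmetric)

text \<open>The products of distinct end point factors \<open>onorm A - t\<close> and
  \<open>onorm A + t\<close>. Up to squares this set is closed under multiplication by either
  factor.\<close>

definition weights :: "real poly set" where
  "weights = {1, [:onorm A, -1:], [:onorm A, 1:], [:onorm A, -1:] * [:onorm A, 1:]}"

text \<open>The linear weights are covered by the Cauchy-Schwarz inequality, their product by the
  operator norm bound \<open>norm (A x) \<le> onorm A * norm x\<close>.\<close>

lemma weight_nonneg:
  assumes "r \<in> weights"
  shows "inner (P r x) x \<ge> 0"
proof -
  let ?M = "onorm A"
  have lin: "P [:?M, c:] x = ?M *\<^sub>R x + c *\<^sub>R A x" for c x
    by (simp add: P_pCons linear_0[OF linear_A] linear_cmul[OF linear_A])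
  have "norm (A x) ^ 2 \<le> (?M * norm x) ^ 2"
    by (intro power_mono norm_le_onorm) simp
  then have "inner (A x) (A x) \<le> ?M * (?M * inner x x)"
    by (simp add: power2_norm_eq_inner power_mult_distrib) (simp add: power2_eq_square mult.assoc)
  moreover have "inner (A x) (A x) = inner x (A (A x))"
    by (rule symmetric)
  ultimately have "inner (P ([:?M, -1:] * [:?M, 1:]) x) x \<ge> 0"
    unfolding P_mult
    by (simp only: lin)
      (simp add: inner_diff_left inner_add_left linear_add[OF linear_A] linear_cmul[OF linear_A]
        scaleR_add_right inner_commute algebra_simps)
  moreover have "inner (P [:?M, -1:] x) x \<ge> 0" "inner (P [:?M, 1:] x) x \<ge> 0"
    using abs_inner_le[of x] by (auto simp: lin inner_diff_left inner_add_left)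
  ultimately show ?thesis
    using assms by (auto simp: weights_def P_1)
qed

text \<open>\<open>s * r\<close> is again a weight, or else the square of \<open>s\<close> times a
  weight. In the first case the hypothesis applies with another weight, in the second the square
  moves to the vector.\<close>

lemma weight_step:
  assumes IH: "\<And>r x. r \<in> weights \<Longrightarrow> inner (P (p * r) x) x \<ge> 0"
    and s: "s \<in> {[:onorm A, -1:], [:onorm A, 1:]}" and r: "r \<in> weights"
  shows "inner (P (s * p * r) x) x \<ge> 0"
proof -
  let ?u = "[:onorm A, -1:]" and ?v = "[:onorm A, 1:]"
  have sq: "inner (P (s * s * (p * r)) x) x \<ge> 0" if "r \<in> weights" for r s
    unfolding poly_square_weight by (rule IH[OF that])
  have mem: "1 \<in> weights" "?u \<in> weights" "?v \<in> weights" "?u * ?v \<in> weights"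
    by (auto simp: weights_def)
  consider "r = 1" | "r = s" | "r \<noteq> s" "r \<in> {?u, ?v}" | "r = ?u * ?v"
    using r by (auto simp: weights_def)
  then show ?thesis
  proof cases
    case 1
    then show ?thesis using IH[of s x] s mem by (auto simp: mult.commute)
  next
    case 2
    then have "s * p * r = s * s * (p * 1)" by (simp only: mult_ac mult_1_right)
    then show ?thesis using sq[OF mem(1)] by metis
  next
    case 3
    then have "s * r = ?u * ?v" using s by (auto simp: mult.commute)
    then have "s * p * r = p * (?u * ?v)" by (metis mult.assoc mult.commute)
    then show ?thesis using IH[OF mem(4)] by metis
  next
    case 4
    from s consider "s = ?u" | "s = ?v" by auto
    then show ?thesis
    proof cases
      case 1
      then have "s * p * r = s * s * (p * ?v)" using 4 by (simp only: mult_ac)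
      then show ?thesis using sq[OF mem(3)] by metis
    next
      case 2
      then have "s * p * r = s * s * (p * ?u)" using 4 by (simp only: mult_ac)
      then show ?thesis using sq[OF mem(2)] by metis
    qed
  qed
qed

text \<open>Away from \<open>z\<close> the factor \<open>s\<close> is positive and can be cancelled.
  At \<open>z\<close> continuity decides, because an interval of positive length has no isolated
  point.\<close>

lemma nonneg_quotient:
  fixes p s f :: "real poly"
  assumes "onorm A > 0" and f: "f = s * p"
    and nonneg: "\<And>t. t \<in> spec_interval \<Longrightarrow> poly f t \<ge> 0"
    and pos: "\<And>t. t \<in> spec_interval - {z} \<Longrightarrow> poly s t > 0"
    and t: "t \<in> spec_interval"
  shows "poly p t \<ge> 0"
proof (rule ccontr)
  assume neg: "\<not> poly p t \<ge> 0"
  have off: "poly p u \<ge> 0" if "u \<in> spec_interval - {z}" for u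
    using nonneg[of u] pos[OF that] that by (simp add: f zero_le_mult_iff)
  then have "t = z" using neg t by auto
  have lim: "(poly p \<longlongrightarrow> poly p t) (at t within spec_interval)"
    using isCont_def poly_isCont tendsto_within_subset by blast
  have "\<forall>\<^sub>F u in at t within spec_interval. poly p u \<ge> 0"
    using off \<open>t = z\<close> by (auto simp: eventually_at_filter)
  moreover have "at t within spec_interval \<noteq> bot"
    using t \<open>onorm A > 0\<close> by (simp add: trivial_limit_within islimpt_Icc)
  ultimately show False
    using neg tendsto_lowerbound[OF lim] by auto
qed

text \<open>
  Subtracting its minimum over the interval from \<open>p\<close> creates a root there. An interior root is a
  double one and splits off a square; a root at an end point splits off one of the weights.
  So \<open>p\<close> lies in the cone generated by products of squares and weights.
\<close>

lemma poly_weight_nonneg: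
  assumes M: "onorm A > 0"
    and nonneg: "\<And>t. t \<in> spec_interval \<Longrightarrow> poly p t \<ge> 0" and r: "r \<in> weights"
  shows "inner (P (p * r) x) x \<ge> 0"
  using nonneg r
\<comment> \<open>\<open>r\<close> and \<open>x\<close> stay arbitrary: a root at an end point
  changes the weight, a double root changes the vector.\<close>
proof (induction "degree p" arbitrary: p r x rule: less_induct)
  case less
  let ?M = "onorm A" and ?u = "[:onorm A, -1:]" and ?v = "[:onorm A, 1:]"
  have const: "inner (P ([:c:] * r) x) x \<ge> 0" if "c \<ge> 0" for c
    unfolding P_mult using weight_nonneg[OF less.prems(2), of x] that by (simp add: P_const)
  have "\<exists>t0\<in>spec_interval. \<forall>t\<in>spec_interval. poly p t0 \<le> poly p t"
    using M by (intro continuous_attains_inf) (auto intro: continuous_intros)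
  then obtain t0 where t0: "t0 \<in> spec_interval"
    and min: "\<And>t. t \<in> spec_interval \<Longrightarrow> poly p t0 \<le> poly p t"
    by blast
  define c where "c = poly p t0"
  have "c \<ge> 0" using less.prems(1) t0 by (simp add: c_def)
  define f where "f = p - [:c:]"
  have p: "p = f + [:c:]" by (simp add: f_def)
  have deg_f: "degree f \<le> degree p" by (simp add: f_def degree_diff_le)
  have f_nonneg: "poly f t \<ge> 0" if "t \<in> spec_interval" for t
    using min[OF that] by (simp add: f_def c_def)
  obtain g where g: "f = [:-t0, 1:] * g"
    using poly_eq_0_iff_dvd[of f t0] by (auto simp: f_def c_def elim: dvdE)
  have "inner (P (f * r) x) x \<ge> 0"
  proof (cases "f = 0")
    case True
    then show ?thesis by simp
  next
    case False
    then have "g \<noteq> 0" using g by auto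
    have deg_g: "degree g < degree p"
      using \<open>g \<noteq> 0\<close> deg_f degree_mult_eq[of "[:-t0, 1:]" g] g by simp
    consider "t0 = ?M" | "t0 = - ?M" | "- ?M < t0" "t0 < ?M"
      using t0 by fastforce
    then show ?thesis
    proof cases
      case 1
      \<comment> \<open>The root factor is \<open>t - onorm A\<close>, the negative of the weight,
        so the sign goes to \<open>g\<close>.\<close>
      have f: "f = ?u * (- g)" using g 1 by (simp add: algebra_simps)
      have "poly (- g) t \<ge> 0" if "t \<in> spec_interval" for t
        by (rule nonneg_quotient[OF M f f_nonneg _ that, where z = ?M]) auto
      then have "inner (P (- g * r) x) x \<ge> 0" if "r \<in> weights" for r x
        using less.hyps[of "- g" r x] deg_g that by auto
      then show ?thesis
        unfolding f by (rule weight_step) (use less.prems(2) in auto)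
    next
      case 2
      have f: "f = ?v * g" using g 2 by simp
      have "poly g t \<ge> 0" if "t \<in> spec_interval" for t
        by (rule nonneg_quotient[OF M f f_nonneg _ that, where z = "- ?M"]) auto
      then have "inner (P (g * r) x) x \<ge> 0" if "r \<in> weights" for r x
        using less.hyps[of g r x] deg_g that by auto
      then show ?thesis
        unfolding f by (rule weight_step) (use less.prems(2) in auto)
    next
      case 3
      \<comment> \<open>\<open>f\<close> is nonnegative on both sides of \<open>t0\<close> while
        \<open>t - t0\<close> changes sign there. The one-sided limits of \<open>g\<close> therefore
        force \<open>poly g t0 = 0\<close>, and the root is double.\<close>
      have lim: "(poly g \<longlongrightarrow> poly g t0) (at t0 within S)" for S
        using isCont_def poly_isCont tendsto_within_subset by blast
      have poly_f: "poly f t = (t - t0) * poly g t" for t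
        by (simp add: g algebra_simps)
      have "\<forall>\<^sub>F t in at_right t0. poly g t \<ge> 0"
      proof -
        have "poly g t \<ge> 0" if "t0 < t" "t < ?M" for t
          using f_nonneg[of t] that 3 by (simp add: poly_f zero_le_mult_iff)
        then show ?thesis unfolding eventually_at_right_field using 3(2) by blast
      qed
      then have "poly g t0 \<ge> 0"
        using tendsto_lowerbound[OF lim] by auto
      have "\<forall>\<^sub>F t in at_left t0. poly g t \<le> 0"
      proof -
        have "poly g t \<le> 0" if "t < t0" "- ?M < t" for t
          using f_nonneg[of t] that 3 by (simp add: poly_f zero_le_mult_iff)
        then show ?thesis unfolding eventually_at_left_field using 3(1) by blast
      qed
      then have "poly g t0 \<le> 0"
        using tendsto_upperbound[OF lim] by auto
      with \<open>poly g t0 \<ge> 0\<close> have "poly g t0 = 0" by simp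
      then obtain h where h: "g = [:-t0, 1:] * h"
        using poly_eq_0_iff_dvd[of g t0] by (auto elim: dvdE)
      have "h \<noteq> 0" using \<open>g \<noteq> 0\<close> h by auto
      have deg_h: "degree h < degree p"
        using \<open>h \<noteq> 0\<close> deg_g degree_mult_eq[of "[:-t0, 1:]" h] h by simp
      let ?s = "[:-t0, 1:]"
      have f: "f = ?s * ?s * h" by (simp only: g h mult.assoc)
      have "poly h t \<ge> 0" if "t \<in> spec_interval" for t
      proof (rule nonneg_quotient[OF M f f_nonneg _ that])
        show "poly (?s * ?s) t > 0" if "t \<in> spec_interval - {t0}" for t
          using that not_real_square_gt_zero[of "t - t0"] by (simp add: algebra_simps)
      qed
      then have "inner (P (h * r) (P ?s x)) (P ?s x) \<ge> 0"
        using less.hyps[OF deg_h _ less.prems(2)] by blast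
      then show ?thesis
        unfolding f mult.assoc[of "?s * ?s"] poly_square_weight .
    qed
  qed
  then show ?case
    using const[OF \<open>c \<ge> 0\<close>]
    by (simp only: p distrib_right poly_of_operator_add inner_add_left)
qed

lemma poly_nonneg:
  assumes nonneg: "\<And>t. t \<in> spec_interval \<Longrightarrow> poly p t \<ge> 0"
  shows "inner (P p x) x \<ge> 0"
proof (cases "onorm A = 0")
  case False
  then show ?thesis
    using poly_weight_nonneg[of p 1 x] onorm_nonneg nonneg by (simp add: weights_def)
next
  \<comment> \<open>The interval degenerates to a point: \<open>A\<close> vanishes and only the
    value of \<open>p\<close> at \<open>0\<close> remains.\<close>
  case True
  then have "A x = 0" for x
    using norm_le_onorm[of x] by simp
  then have "P p x = poly p 0 *\<^sub>R x"
    by (cases p) (simp add: P_pCons)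
  then show ?thesis
    using nonneg[of 0] True by simp
qed

text \<open>Positivity of the form of \<open>c\<^sup>2 - p * p\<close> is the squared estimate, by
  symmetry of \<open>P p\<close>.\<close>

lemma norm_poly_le:
  assumes bound: "\<And>t. t \<in> spec_interval \<Longrightarrow> \<bar>poly p t\<bar> \<le> c" and "c \<ge> 0"
  shows "norm (P p x) \<le> c * norm x"
proof (rule power2_le_imp_le)
  have "poly ([:c\<^sup>2:] - p * p) t \<ge> 0" if "t \<in> spec_interval" for t
    using power_mono[OF bound[OF that], of 2] by (simp add: power2_eq_square)
  then have "inner (P ([:c\<^sup>2:] - p * p) x) x \<ge> 0"
    by (rule poly_nonneg)
  then show "(norm (P p x))\<^sup>2 \<le> (c * norm x)\<^sup>2"
    by (simp add: poly_of_operator_diff inner_diff_left P_const P_mult poly_symmetric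
        power_mult_distrib power2_norm_eq_inner)
  show "0 \<le> c * norm x" using \<open>c \<ge> 0\<close> by simp
qed

end

section \<open>Extension from polynomials to continuous functions\<close>

lemma uniform_limit_polynomials_exist:
  fixes f :: "real \<Rightarrow> real"
  assumes "continuous_on {u..v} f"
  obtains p :: "nat \<Rightarrow> real poly"
  where "uniform_limit {u..v} (\<lambda>n t. poly (p n) t) f sequentially"
proof -
  obtain g where g: "uniform_limit {u..v} g f sequentially" "\<And>n. polynomial_function (g n)"
    using Stone_Weierstrass_uniform_limit[OF compact_Icc assms] by blast
  have "\<exists>p. poly p = g n" for n
  proof -
    have "real_polynomial_function (g n)"
      using g(2) by (simp add: real_polynomial_function_eq)
    then obtain c k where "g n = (\<lambda>x. \<Sum>i\<le>k. c i * x ^ i)"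
      by (metis real_polynomial_function_iff_sum)
    then have "poly (\<Sum>i\<le>k. monom (c i) i) = g n"
      by (simp add: fun_eq_iff poly_sum poly_monom)
    then show ?thesis ..
  qed
  then obtain p where "\<And>n. poly (p n) = g n" by metis
  with g(1) show thesis by (intro that[of p]) simp
qed

context symmetric_operator
begin

abbreviation \<Phi> :: "(real \<Rightarrow> real) \<Rightarrow> 'a \<Rightarrow> 'a" where
  "\<Phi> f \<equiv> spectral_calculus f A"

abbreviation approximates :: "(nat \<Rightarrow> real poly) \<Rightarrow> (real \<Rightarrow> real) \<Rightarrow> bool" where
  "approximates p f \<equiv> uniform_limit spec_interval (\<lambda>n t. poly (p n) t) f sequentially"

lemma zero_in_spec_interval: "0 \<in> spec_interval"
  using onorm_nonneg by simp

lemma approximates_exist: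
  assumes "continuous_on spec_interval f"
  obtains p where "approximates p f"
  using uniform_limit_polynomials_exist[OF assms] by blast

lemma poly_seq_Cauchy:
  assumes "approximates p f"
  shows "Cauchy (\<lambda>n. P (p n) x)"
proof (rule metric_CauchyI)
  fix e :: real assume "e > 0"
  define d where "d = e / (2 * (norm x + 1))"
  have nx: "norm x + 1 > 0" using norm_ge_zero[of x] by linarith
  have "d > 0" using \<open>e > 0\<close> nx by (simp add: d_def)
  then obtain N where N: "\<And>n t. n \<ge> N \<Longrightarrow> t \<in> spec_interval \<Longrightarrow> dist (poly (p n) t) (f t) < d / 2"
    using assms unfolding uniform_limit_sequentially_iff by (meson half_gt_zero)
  have "dist (P (p i) x) (P (p j) x) < e" if "i \<ge> N" "j \<ge> N" for i j
  proof -
    have "\<bar>poly (p i - p j) t\<bar> \<le> d" if "t \<in> spec_interval" for t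
      using N[OF \<open>i \<ge> N\<close> that] N[OF \<open>j \<ge> N\<close> that]
      unfolding dist_real_def poly_diff by linarith
    then have "norm (P (p i - p j) x) \<le> d * norm x"
      using \<open>d > 0\<close> by (intro norm_poly_le) auto
    also have "\<dots> < d * (2 * (norm x + 1))"
      using \<open>d > 0\<close> nx by (intro mult_strict_left_mono) auto
    also have "\<dots> = e"
      using nx by (simp add: d_def)
    finally show ?thesis by (simp add: poly_of_operator_diff dist_norm)
  qed
  then show "\<exists>N. \<forall>i\<ge>N. \<forall>j\<ge>N. dist (P (p i) x) (P (p j) x) < e" by blast
qed

text \<open>The definition asks for a limit common to all approximating sequences. Two such
  sequences interleave to a third one, along which the values converge as well; so all limits agree
  and the description is well defined.\<close>

lemma spectral_calculus_tendsto:
  assumes "continuous_on spec_interval f" and p: "approximates p f"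
  shows "(\<lambda>n. P (p n) x) \<longlonglongrightarrow> \<Phi> f x"
proof -
  obtain z where z: "(\<lambda>n. P (p n) x) \<longlonglongrightarrow> z"
    using poly_seq_Cauchy[OF p, of x] Cauchy_convergent_iff convergent_def by blast
  have lim: "(\<lambda>n. P (r n) x) \<longlonglongrightarrow> z" if r: "approximates r f" for r
  proof -
    let ?s = "\<lambda>n. if even n then p (n div 2) else r (n div 2)"
    have "approximates ?s f"
      unfolding uniform_limit_sequentially_iff
    proof (intro allI impI)
      fix e :: real assume "e > 0"
      then obtain N1 N2
        where N1: "\<And>n t. n \<ge> N1 \<Longrightarrow> t \<in> spec_interval \<Longrightarrow> dist (poly (p n) t) (f t) < e"
          and N2: "\<And>n t. n \<ge> N2 \<Longrightarrow> t \<in> spec_interval \<Longrightarrow> dist (poly (r n) t) (f t) < e"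
        using p r unfolding uniform_limit_sequentially_iff by meson
      have "\<forall>n\<ge>2 * max N1 N2. \<forall>t\<in>spec_interval. dist (poly (?s n) t) (f t) < e"
      proof (intro allI impI ballI)
        fix n t assume "n \<ge> 2 * max N1 N2" and t: "t \<in> spec_interval"
        then have "n div 2 \<ge> N1" "n div 2 \<ge> N2" by linarith+
        then show "dist (poly (?s n) t) (f t) < e" using N1 N2 t by auto
      qed
      then show "\<exists>N. \<forall>n\<ge>N. \<forall>t\<in>spec_interval. dist (poly (?s n) t) (f t) < e" by blast
    qed
    then have C: "Cauchy (\<lambda>n. P (?s n) x)" by (rule poly_seq_Cauchy)
    then obtain l where l: "(\<lambda>n. P (?s n) x) \<longlonglongrightarrow> l"
      using Cauchy_convergent_iff convergent_def by blast
    have "(\<lambda>n. P (?s (2 * n)) x) \<longlonglongrightarrow> l" "(\<lambda>n. P (?s (2 * n + 1)) x) \<longlonglongrightarrow> l"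
      using LIMSEQ_subseq_LIMSEQ[OF l, of "\<lambda>n. 2 * n"]
        LIMSEQ_subseq_LIMSEQ[OF l, of "\<lambda>n. 2 * n + 1"]
      by (auto simp: strict_mono_def comp_def)
    then have "(\<lambda>n. P (p n) x) \<longlonglongrightarrow> l" "(\<lambda>n. P (r n) x) \<longlonglongrightarrow> l" by simp_all
    then show ?thesis using LIMSEQ_unique[OF z] by blast
  qed
  have "\<Phi> f x = z"
    unfolding spectral_calculus_def
    by (rule the_equality) (use lim p LIMSEQ_unique[OF z] in blast)+
  then show ?thesis using z by simp
qed

lemma spectral_calculus_poly: "\<Phi> (poly p) x = P p x"
proof -
  have "(\<lambda>n. P p x) \<longlonglongrightarrow> \<Phi> (poly p) x"
    by (rule spectral_calculus_tendsto)
      (auto intro!: continuous_intros simp: uniform_limit_const)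
  then show ?thesis using LIMSEQ_const_iff by metis
qed

lemma spectral_calculus_id: "\<Phi> (\<lambda>t. t) x = A x"
proof -
  have "poly [:0, 1:] = (\<lambda>t::real. t)" by (simp add: fun_eq_iff)
  then show ?thesis
    using spectral_calculus_poly[of "[:0, 1:]" x] by (simp add: P_pCons linear_0[OF linear_A])
qed

lemma spectral_calculus_const: "\<Phi> (\<lambda>_. c) x = c *\<^sub>R x"
proof -
  have "poly [:c:] = (\<lambda>_. c)" by (simp add: fun_eq_iff)
  then show ?thesis
    using spectral_calculus_poly[of "[:c:]" x] by (simp add: P_const)
qed

lemma spectral_calculus_cong:
  assumes "\<And>t. t \<in> spec_interval \<Longrightarrow> f t = g t"
  shows "\<Phi> f x = \<Phi> g x"
proof -
  have "approximates p f = approximates p g" for p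
    using assms by (intro uniform_limit_cong') auto
  then show ?thesis by (simp add: spectral_calculus_def)
qed

lemma spectral_calculus_add:
  assumes f: "continuous_on spec_interval f" and g: "continuous_on spec_interval g"
  shows "\<Phi> (\<lambda>t. f t + g t) x = \<Phi> f x + \<Phi> g x"
proof -
  obtain p r where p: "approximates p f" and r: "approximates r g"
    using approximates_exist f g by metis
  have "approximates (\<lambda>n. p n + r n) (\<lambda>t. f t + g t)"
    using uniform_limit_add[OF p r] by simp
  then have "(\<lambda>n. P (p n + r n) x) \<longlonglongrightarrow> \<Phi> (\<lambda>t. f t + g t) x"
    by (intro spectral_calculus_tendsto continuous_intros f g)
  moreover have "(\<lambda>n. P (p n + r n) x) \<longlonglongrightarrow> \<Phi> f x + \<Phi> g x"
    unfolding poly_of_operator_add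
    by (intro tendsto_add spectral_calculus_tendsto f g p r)
  ultimately show ?thesis by (rule LIMSEQ_unique)
qed

text \<open>Approximating polynomials are eventually bounded by \<open>c + e\<close>, so the
  polynomial estimate applies with this constant; then \<open>e\<close> tends to
  \<open>0\<close>.\<close>

lemma norm_spectral_calculus_le:
  assumes f: "continuous_on spec_interval f"
    and bound: "\<And>t. t \<in> spec_interval \<Longrightarrow> \<bar>f t\<bar> \<le> c"
  shows "norm (\<Phi> f x) \<le> c * norm x"
proof -
  have "c \<ge> 0" using bound[OF zero_in_spec_interval] by linarith
  obtain p where p: "approximates p f" using approximates_exist f by blast
  have le: "norm (\<Phi> f x) \<le> (c + e) * norm x" if "e > 0" for e
  proof (rule tendsto_upperbound[OF tendsto_norm[OF spectral_calculus_tendsto[OF f p]]])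
    show "\<forall>\<^sub>F n in sequentially. norm (P (p n) x) \<le> (c + e) * norm x"
      using uniform_limitD[OF p that]
    proof eventually_elim
      case (elim n)
      have "\<bar>poly (p n) t\<bar> \<le> c + e" if "t \<in> spec_interval" for t
        using elim bound[OF that] that by (force simp: dist_real_def)
      then show ?case
        using \<open>c \<ge> 0\<close> \<open>e > 0\<close> by (intro norm_poly_le) auto
    qed
  qed simp
  have "((\<lambda>e. (c + e) * norm x) \<longlongrightarrow> (c + 0) * norm x) (at_right 0)"
    by (intro tendsto_intros)
  moreover have "\<forall>\<^sub>F e in at_right 0. norm (\<Phi> f x) \<le> (c + e) * norm x"
    using le by (simp add: eventually_at_right_field) (metis zero_less_one)
  ultimately show ?thesis
    by (metis add.right_neutral tendsto_lowerbound trivial_limit_at_right_real)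
qed

lemma spectral_calculus_vector_add:
  assumes "continuous_on spec_interval f"
  shows "\<Phi> f (x + y) = \<Phi> f x + \<Phi> f y"
proof -
  obtain p where p: "approximates p f" using approximates_exist assms by blast
  have "(\<lambda>n. P (p n) (x + y)) \<longlonglongrightarrow> \<Phi> f x + \<Phi> f y"
    unfolding linear_add[OF linear_poly]
    by (intro tendsto_add spectral_calculus_tendsto assms p)
  then show ?thesis
    using spectral_calculus_tendsto[OF assms p] LIMSEQ_unique by blast
qed

lemma spectral_calculus_vector_scaleR:
  assumes "continuous_on spec_interval f"
  shows "\<Phi> f (c *\<^sub>R x) = c *\<^sub>R \<Phi> f x"
proof -
  obtain p where p: "approximates p f" using approximates_exist assms by blast
  have "(\<lambda>n. P (p n) (c *\<^sub>R x)) \<longlonglongrightarrow> c *\<^sub>R \<Phi> f x"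
    unfolding linear_cmul[OF linear_poly]
    by (intro tendsto_intros spectral_calculus_tendsto assms p)
  then show ?thesis
    using spectral_calculus_tendsto[OF assms p] LIMSEQ_unique by blast
qed

text \<open>Together with symmetry this makes \<open>\<Phi> g\<close> a
  \<open>symmetric_operator\<close> of its own, so that the calculus can be applied to it
  again.\<close>

lemma bounded_linear_spectral_calculus:
  assumes "continuous_on spec_interval f"
  shows "bounded_linear (\<Phi> f)"
proof -
  have "\<exists>c. \<forall>t\<in>spec_interval. \<bar>f t\<bar> \<le> c"
    using compact_imp_bounded[OF compact_continuous_image[OF assms compact_Icc]]
    by (auto simp: bounded_iff)
  then obtain c where "\<And>t. t \<in> spec_interval \<Longrightarrow> \<bar>f t\<bar> \<le> c" by blast
  then have "norm (\<Phi> f x) \<le> norm x * c" for x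
    using norm_spectral_calculus_le[OF assms] by (simp add: mult.commute)
  then show ?thesis
    using spectral_calculus_vector_add[OF assms] spectral_calculus_vector_scaleR[OF assms]
    by (intro bounded_linear_intro)
qed

lemma spectral_calculus_symmetric:
  assumes "continuous_on spec_interval f"
  shows "inner (\<Phi> f x) y = inner x (\<Phi> f y)"
proof -
  obtain p where p: "approximates p f" using approximates_exist assms by blast
  have "(\<lambda>n. inner (P (p n) x) y) \<longlonglongrightarrow> inner (\<Phi> f x) y"
    by (intro tendsto_intros spectral_calculus_tendsto assms p)
  moreover have "(\<lambda>n. inner (P (p n) x) y) \<longlonglongrightarrow> inner x (\<Phi> f y)"
    unfolding poly_symmetric by (intro tendsto_intros spectral_calculus_tendsto assms p)
  ultimately show ?thesis by (rule LIMSEQ_unique)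
qed

text \<open>First half of multiplicativity: the polynomial stays fixed and only \<open>g\<close> is
  approximated. The general product then follows by approximating the other factor.\<close>

lemma spectral_calculus_mult_poly:
  assumes g: "continuous_on spec_interval g"
  shows "\<Phi> (\<lambda>t. poly p t * g t) x = P p (\<Phi> g x)"
proof -
  obtain r where r: "approximates r g" using approximates_exist g by blast
  have bdd: "bounded (poly p ` spec_interval)" "bounded (g ` spec_interval)"
    by (intro compact_imp_bounded compact_continuous_image compact_Icc continuous_intros g)+
  have "approximates (\<lambda>n. p * r n) (\<lambda>t. poly p t * g t)"
    using uniform_lim_mult[OF uniform_limit_const r bdd] by simp
  then have "(\<lambda>n. P (p * r n) x) \<longlonglongrightarrow> \<Phi> (\<lambda>t. poly p t * g t) x"
    by (intro spectral_calculus_tendsto continuous_intros g)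
  moreover have "(\<lambda>n. P (p * r n) x) \<longlonglongrightarrow> P p (\<Phi> g x)"
    unfolding P_mult
    by (intro bounded_linear.tendsto[OF bounded_linear_poly] spectral_calculus_tendsto g r)
  ultimately show ?thesis by (rule LIMSEQ_unique)
qed

lemma spectral_calculus_diff:
  assumes f: "continuous_on spec_interval f" and g: "continuous_on spec_interval g"
  shows "\<Phi> (\<lambda>t. f t - g t) x = \<Phi> f x - \<Phi> g x"
  using spectral_calculus_add[of "\<lambda>t. f t - g t" g x] f g
  by (simp add: continuous_on_diff)

text \<open>Continuity under uniform convergence for arbitrary continuous approximants; the
  definition speaks of polynomial ones.\<close>

lemma tendsto_spectral_calculus:
  assumes h: "\<And>n. continuous_on spec_interval (h n)"
    and lim: "uniform_limit spec_interval h f sequentially"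
  shows "(\<lambda>n. \<Phi> (h n) x) \<longlonglongrightarrow> \<Phi> f x"
proof (rule LIMSEQ_I)
  have f: "continuous_on spec_interval f"
    by (rule uniform_limit_theorem[OF _ lim]) (use h in auto)
  fix e :: real assume "e > 0"
  define d where "d = e / (norm x + 1)"
  have nx: "norm x + 1 > 0" using norm_ge_zero[of x] by linarith
  have "d > 0" using \<open>e > 0\<close> nx by (simp add: d_def)
  then obtain N where N: "\<And>n t. n \<ge> N \<Longrightarrow> t \<in> spec_interval \<Longrightarrow> dist (h n t) (f t) < d"
    using lim unfolding uniform_limit_sequentially_iff by meson
  have "norm (\<Phi> (h n) x - \<Phi> f x) < e" if "n \<ge> N" for n
  proof -
    have "norm (\<Phi> (\<lambda>t. h n t - f t) x) \<le> d * norm x"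
      using N[OF that] f h
      by (intro norm_spectral_calculus_le) (auto intro!: continuous_intros less_imp_le simp: dist_real_def)
    also have "\<dots> < d * (norm x + 1)"
      using \<open>d > 0\<close> by simp
    also have "\<dots> = e" using nx by (simp add: d_def)
    finally show ?thesis by (simp only: spectral_calculus_diff[OF h f])
  qed
  then show "\<exists>N. \<forall>n\<ge>N. norm (\<Phi> (h n) x - \<Phi> f x) < e" by blast
qed

lemma spectral_calculus_mult:
  assumes f: "continuous_on spec_interval f" and g: "continuous_on spec_interval g"
  shows "\<Phi> (\<lambda>t. f t * g t) x = \<Phi> f (\<Phi> g x)"
proof -
  obtain p where p: "approximates p f" using approximates_exist f by blast
  have bdd: "bounded (f ` spec_interval)" "bounded (g ` spec_interval)"
    by (intro compact_imp_bounded compact_continuous_image compact_Icc f g)+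
  have lim: "uniform_limit spec_interval (\<lambda>n t. poly (p n) t * g t) (\<lambda>t. f t * g t) sequentially"
    using uniform_lim_mult[OF p uniform_limit_const bdd] .
  have "(\<lambda>n. \<Phi> (\<lambda>t. poly (p n) t * g t) x) \<longlonglongrightarrow> \<Phi> (\<lambda>t. f t * g t) x"
    by (rule tendsto_spectral_calculus[OF _ lim]) (intro continuous_intros g)
  then have "(\<lambda>n. P (p n) (\<Phi> g x)) \<longlonglongrightarrow> \<Phi> (\<lambda>t. f t * g t) x"
    by (simp only: spectral_calculus_mult_poly[OF g])
  then show ?thesis
    using spectral_calculus_tendsto[OF f p] LIMSEQ_unique by blast
qed

text \<open>The root of \<open>f\<close> belongs to the calculus, so the quadratic form is the
  square of a norm.\<close>

lemma spectral_calculus_nonneg: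
  assumes f: "continuous_on spec_interval f"
    and nonneg: "\<And>t. t \<in> spec_interval \<Longrightarrow> f t \<ge> 0"
  shows "inner (\<Phi> f x) x \<ge> 0"
proof -
  have s: "continuous_on spec_interval (\<lambda>t. sqrt (f t))"
    by (intro continuous_intros f)
  have "\<Phi> f x = \<Phi> (\<lambda>t. sqrt (f t) * sqrt (f t)) x"
    by (rule spectral_calculus_cong) (use nonneg in simp)
  also have "\<dots> = \<Phi> (\<lambda>t. sqrt (f t)) (\<Phi> (\<lambda>t. sqrt (f t)) x)"
    by (rule spectral_calculus_mult[OF s s])
  finally have "inner (\<Phi> f x) x =
      inner (\<Phi> (\<lambda>t. sqrt (f t)) x) (\<Phi> (\<lambda>t. sqrt (f t)) x)"
    by (simp only: spectral_calculus_symmetric[OF s])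
  then show ?thesis by simp
qed

text \<open>Horner's rule for the operator \<open>\<Phi> g\<close> meets the sum and product rules
  for \<open>A\<close>. This is the polynomial case of the composition rule.\<close>

lemma poly_spectral_calculus:
  assumes g: "continuous_on spec_interval g"
  shows "poly_of_operator p (\<Phi> g) x = \<Phi> (\<lambda>t. poly p (g t)) x"
proof -
  interpret G: symmetric_operator "\<Phi> g"
    by (rule symmetric_operator.intro[OF bounded_linear_spectral_calculus[OF g]
        spectral_calculus_symmetric[OF g]])
  show ?thesis
  proof (induction p)
    case 0
    then show ?case using spectral_calculus_const[of 0 x] by simp
  next
    case (pCons c p)
    have cont: "continuous_on spec_interval (\<lambda>t. poly p (g t))"
      by (intro continuous_intros g)
    have "\<Phi> (\<lambda>t. c + g t * poly p (g t)) x = c *\<^sub>R x + \<Phi> (\<lambda>t. g t * poly p (g t)) x"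
      by (subst spectral_calculus_add) (auto intro!: continuous_intros g simp: spectral_calculus_const)
    also have "\<Phi> (\<lambda>t. g t * poly p (g t)) x = \<Phi> g (\<Phi> (\<lambda>t. poly p (g t)) x)"
      by (rule spectral_calculus_mult[OF g cont])
    finally show ?case by (simp add: G.P_pCons pCons.IH)
  qed
qed

text \<open>
  Approximating \<open>f\<close> on an interval that contains both \<open>{- onorm (\<Phi> g)..onorm (\<Phi> g)}\<close> and
  the range of \<open>g\<close> avoids the comparison of the two.
\<close>

lemma spectral_calculus_compose:
  assumes g: "continuous_on spec_interval g" and f: "continuous_on UNIV f"
  shows "spectral_calculus f (\<Phi> g) x = \<Phi> (\<lambda>t. f (g t)) x"
proof -
  interpret G: symmetric_operator "\<Phi> g"
    by (rule symmetric_operator.intro[OF bounded_linear_spectral_calculus[OF g]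
        spectral_calculus_symmetric[OF g]])
  have fI: "continuous_on S f" for S
    using f continuous_on_subset by blast
  have "\<exists>c. \<forall>t\<in>spec_interval. \<bar>g t\<bar> \<le> c"
    using compact_imp_bounded[OF compact_continuous_image[OF g compact_Icc]]
    by (auto simp: bounded_iff)
  then obtain c where c: "\<And>t. t \<in> spec_interval \<Longrightarrow> \<bar>g t\<bar> \<le> c" by blast
  define b where "b = max c (onorm (\<Phi> g))"
  obtain p :: "nat \<Rightarrow> real poly"
    where p: "uniform_limit {- b..b} (\<lambda>n t. poly (p n) t) f sequentially"
    using uniform_limit_polynomials_exist fI by blast
  have "G.approximates p f"
    by (rule uniform_limit_on_subset[OF p]) (auto simp: b_def)
  then have "(\<lambda>n. G.P (p n) x) \<longlonglongrightarrow> G.\<Phi> f x"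
    by (rule G.spectral_calculus_tendsto[OF fI])
  moreover have "(\<lambda>n. G.P (p n) x) \<longlonglongrightarrow> \<Phi> (\<lambda>t. f (g t)) x"
    unfolding poly_spectral_calculus[OF g]
  proof (rule tendsto_spectral_calculus)
    have "g \<in> spec_interval \<rightarrow> {- b..b}"
      using c by (fastforce simp: b_def)
    then show "uniform_limit spec_interval (\<lambda>n t. poly (p n) (g t)) (\<lambda>t. f (g t)) sequentially"
      by (rule uniform_limit_compose'[OF p])
  qed (intro continuous_intros g)
  ultimately show ?thesis by (rule LIMSEQ_unique)
qed

end

section \<open>Self-adjoint operators that are bounded below\<close>

text \<open>The identity that describes the graph of the adjoint survives limits, and this graph is
  the graph of \<open>B\<close>.\<close>

lemma self_adjoint_closed:
  assumes sa: "self_adjoint D B" and u: "\<And>n::nat. u n \<in> D"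
    and lim: "u \<longlonglongrightarrow> x" "(\<lambda>n. B (u n)) \<longlonglongrightarrow> z"
  shows "x \<in> D \<and> B x = z"
proof -
  have adj: "(\<forall>v\<in>D. inner (B v) y = inner v z) \<longleftrightarrow> y \<in> D \<and> B y = z" for y z
    using sa by (simp add: self_adjoint_def)
  have "inner (B v) x = inner v z" if "v \<in> D" for v
  proof -
    have "inner (B v) (u n) = inner v (B (u n))" for n
      using adj[of "u n" "B (u n)"] u that by blast
    moreover have "(\<lambda>n. inner (B v) (u n)) \<longlonglongrightarrow> inner (B v) x"
      "(\<lambda>n. inner v (B (u n))) \<longlonglongrightarrow> inner v z"
      by (intro tendsto_intros lim)+
    ultimately show ?thesis using LIMSEQ_unique by simp
  qed
  then show ?thesis using adj by blast
qed

lemma parallelogram_midpoint: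
  fixes x y :: "'a::real_inner"
  shows "(norm (x - y))\<^sup>2 = 2 * (norm x)\<^sup>2 + 2 * (norm y)\<^sup>2 - 4 * (norm ((1 / 2) *\<^sub>R (x + y)))\<^sup>2"
  by (simp add: power2_norm_eq_inner inner_diff_left inner_diff_right inner_add_left
      inner_add_right inner_commute field_simps)

lemma norm_diff_scaleR_square:
  fixes x y :: "'a::real_inner"
  shows "(norm (x - c *\<^sub>R y))\<^sup>2 = (norm x)\<^sup>2 - 2 * c * inner y x + c\<^sup>2 * (norm y)\<^sup>2"
  by (simp add: power2_norm_eq_inner inner_diff_left inner_diff_right inner_commute)
    (simp add: power2_eq_square algebra_simps)

locale bounded_below_self_adjoint =
  fixes D :: "'a::{real_inner, complete_space} set" and B :: "'a \<Rightarrow> 'a" and m :: real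
  assumes self_adjoint: "self_adjoint D B" and m_pos: "m > 0"
    and bounded_below: "\<And>x. x \<in> D \<Longrightarrow> norm (B x) \<ge> m * norm x"
begin

lemma subspace: "subspace D"
  using self_adjoint by (simp add: self_adjoint_def linear_operator_on_def)

lemma B_add: "x \<in> D \<Longrightarrow> y \<in> D \<Longrightarrow> B (x + y) = B x + B y"
  and B_scaleR: "x \<in> D \<Longrightarrow> B (c *\<^sub>R x) = c *\<^sub>R B x"
  using self_adjoint by (simp_all add: self_adjoint_def linear_operator_on_def)

lemma B_diff: "x \<in> D \<Longrightarrow> y \<in> D \<Longrightarrow> B (x - y) = B x - B y"
  using B_add[of x "- y"] B_scaleR[of y "-1"] subspace_neg[OF subspace] by simp

lemma B_symmetric: "x \<in> D \<Longrightarrow> y \<in> D \<Longrightarrow> inner (B x) y = inner x (B y)"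
  using self_adjoint unfolding self_adjoint_def by blast

lemma B_inj: "inj_on B D"
proof (rule inj_onI)
  fix x y assume "x \<in> D" "y \<in> D" "B x = B y"
  then have "m * norm (x - y) \<le> 0"
    using bounded_below[of "x - y"] subspace_diff[OF subspace] by (simp add: B_diff)
  then show "x = y" using m_pos by (simp add: mult_le_0_iff)
qed

text \<open>
  A minimizing sequence of \<open>norm (B x - v)\<close> converges by the parallelogram law, and the residual
  at its limit is orthogonal to the range of \<open>B\<close>, hence in the kernel of the adjoint.
\<close>

lemma B_surj: "B ` D = UNIV"
proof -
  have "v \<in> B ` D" for v
  proof -
    define S where "S = (\<lambda>x. (norm (B x - v))\<^sup>2) ` D"
    define s where "s = Inf S"
    have "0 \<in> D" using subspace_0[OF subspace] .
    then have "S \<noteq> {}" by (auto simp: S_def)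
    have bdd: "bdd_below S" by (auto simp: S_def intro!: bdd_belowI[of _ 0])
    have s_le: "s \<le> (norm (B x - v))\<^sup>2" if "x \<in> D" for x
      unfolding s_def using that by (intro cInf_lower bdd) (auto simp: S_def)
    have "\<exists>x\<in>D. (norm (B x - v))\<^sup>2 < s + inverse (Suc n)" for n
    proof -
      have "Inf S < s + inverse (Suc n)" by (simp add: s_def)
      then show ?thesis using cInf_lessD[OF \<open>S \<noteq> {}\<close>] by (auto simp: S_def)
    qed
    then obtain u where u: "\<And>n. u n \<in> D"
      and u_less: "\<And>n. (norm (B (u n) - v))\<^sup>2 < s + inverse (Suc n)"
      by metis
    \<comment> \<open>The midpoint of \<open>u i\<close> and \<open>u j\<close> lies in
      \<open>D\<close>, so its squared residual is at least \<open>s\<close>; the parallelogram law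
      turns this into closeness of the images.\<close>
    have diff: "(norm (B (u i) - B (u j)))\<^sup>2 < 2 * inverse (Suc i) + 2 * inverse (Suc j)" for i j
    proof -
      let ?mid = "(1 / 2) *\<^sub>R (u i + u j)"
      have "?mid \<in> D" using u subspace by (simp add: subspace_def)
      have "B ?mid - v = (1 / 2) *\<^sub>R ((B (u i) - v) + (B (u j) - v))"
      proof -
        have "B ?mid = (1 / 2) *\<^sub>R (B (u i) + B (u j))"
          using u subspace_add[OF subspace] by (simp only: B_scaleR B_add)
        moreover have "(1 / 2) *\<^sub>R (v + v) = v" by (simp flip: scaleR_2)
        moreover have "(B (u i) - v) + (B (u j) - v) = (B (u i) + B (u j)) - (v + v)" by simp
        ultimately show ?thesis by (simp only: scaleR_diff_right[of _ _ "v + v"])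
      qed
      then have "s \<le> (norm ((1 / 2) *\<^sub>R ((B (u i) - v) + (B (u j) - v))))\<^sup>2"
        using s_le[OF \<open>?mid \<in> D\<close>] by simp
      then show ?thesis
        using parallelogram_midpoint[of "B (u i) - v" "B (u j) - v"] u_less[of i] u_less[of j]
        by simp
    qed
    have "Cauchy (\<lambda>n. B (u n))"
    proof (rule metric_CauchyI)
      fix e :: real assume "e > 0"
      \<comment> \<open>The bound in \<open>diff\<close> is at most
        \<open>4 * inverse (Suc M)\<close>, whence the quarter.\<close>
      then obtain M where M: "inverse (Suc M) < e\<^sup>2 / 4"
        using reals_Archimedean[of "e\<^sup>2 / 4"] by auto
      have "dist (B (u i)) (B (u j)) < e" if "i \<ge> M" "j \<ge> M" for i j
      proof -
        have "inverse (real (Suc i)) \<le> inverse (Suc M)" "inverse (real (Suc j)) \<le> inverse (Suc M)"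
          using that by (auto intro!: le_imp_inverse_le)
        then have "(norm (B (u i) - B (u j)))\<^sup>2 < e\<^sup>2"
          using diff[of i j] M by linarith
        then show ?thesis
          using \<open>e > 0\<close> power_less_imp_less_base[of "norm (B (u i) - B (u j))" 2 e]
          by (simp add: dist_norm)
      qed
      then show "\<exists>M. \<forall>i\<ge>M. \<forall>j\<ge>M. dist (B (u i)) (B (u j)) < e" by blast
    qed
    then obtain z where z: "(\<lambda>n. B (u n)) \<longlonglongrightarrow> z"
      using Cauchy_convergent_iff convergent_def by blast
    have "Cauchy u"
    proof (rule metric_CauchyI)
      fix e :: real assume "e > 0"
      then obtain M where M: "\<And>i j. i \<ge> M \<Longrightarrow> j \<ge> M \<Longrightarrow> dist (B (u i)) (B (u j)) < m * e"
        using metric_CauchyD[OF \<open>Cauchy (\<lambda>n. B (u n))\<close>, of "m * e"] m_pos by auto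
      have "dist (u i) (u j) < e" if "i \<ge> M" "j \<ge> M" for i j
      proof -
        have "m * norm (u i - u j) < m * e"
          using bounded_below[OF subspace_diff[OF subspace u u], of i j] M[OF that]
          by (simp add: B_diff u dist_norm)
        then show ?thesis using m_pos by (simp add: dist_norm)
      qed
      then show "\<exists>M. \<forall>i\<ge>M. \<forall>j\<ge>M. dist (u i) (u j) < e" by blast
    qed
    then obtain x where "u \<longlonglongrightarrow> x"
      using Cauchy_convergent_iff convergent_def by blast
    then have x: "x \<in> D" "B x = z"
      using self_adjoint_closed[OF self_adjoint u _ z] by blast+
    have "(norm (z - v))\<^sup>2 \<le> s"
    proof (rule LIMSEQ_le)
      show "(\<lambda>n. (norm (B (u n) - v))\<^sup>2) \<longlonglongrightarrow> (norm (z - v))\<^sup>2"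
        by (intro tendsto_intros z)
      show "(\<lambda>n. s + inverse (Suc n)) \<longlonglongrightarrow> s"
        using tendsto_add[OF tendsto_const LIMSEQ_inverse_real_of_nat, of s] by simp
      show "\<exists>N. \<forall>n\<ge>N. (norm (B (u n) - v))\<^sup>2 \<le> s + inverse (Suc n)"
        using u_less less_imp_le by blast
    qed
    have orth: "inner (B y) (z - v) = 0" if "y \<in> D" for y
    proof -
      define b where "b = inner (B y) (z - v)"
      \<comment> \<open>Moving \<open>x\<close> along \<open>y\<close> by \<open>b / n\<close>
        cannot decrease the residual. The optimal denominator is
        \<open>(norm (B y))\<^sup>2\<close>; the added \<open>1\<close> keeps it positive when
        \<open>B y = 0\<close>.\<close>
      define n where "n = (norm (B y))\<^sup>2 + 1"
      have "n > 0" by (simp add: n_def add_nonneg_pos)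
      have "x - (b / n) *\<^sub>R y \<in> D"
        using x that subspace by (simp add: subspace_diff subspace_scale)
      from s_le[OF this] \<open>(norm (z - v))\<^sup>2 \<le> s\<close>
      have "(norm (z - v))\<^sup>2 \<le> (norm (B (x - (b / n) *\<^sub>R y) - v))\<^sup>2"
        by linarith
      also have "B (x - (b / n) *\<^sub>R y) - v = (z - v) - (b / n) *\<^sub>R B y"
        using x that subspace by (simp add: B_diff B_scaleR subspace_scale)
      also have "(norm ((z - v) - (b / n) *\<^sub>R B y))\<^sup>2 = (norm (z - v))\<^sup>2 - 2 * (b / n) * b + (b / n)\<^sup>2 * (norm (B y))\<^sup>2"
        by (simp add: norm_diff_scaleR_square b_def)
      also have "(b / n)\<^sup>2 * (norm (B y))\<^sup>2 \<le> (b / n)\<^sup>2 * n"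
        by (intro mult_left_mono) (auto simp: n_def)
      also have "\<dots> = (b / n) * b" using \<open>n > 0\<close> by (simp add: power2_eq_square)
      finally have "(b / n) * b \<le> 0" by simp
      then have "b\<^sup>2 \<le> 0"
        using \<open>n > 0\<close> by (simp add: power2_eq_square divide_le_0_iff)
      then show ?thesis by (simp add: b_def)
    qed
    have "\<forall>y\<in>D. inner (B y) (z - v) = inner y 0" using orth by simp
    then have "z - v \<in> D \<and> B (z - v) = 0"
      using self_adjoint unfolding self_adjoint_def by blast
    then have "m * norm (z - v) \<le> 0"
      using bounded_below[of "z - v"] by simp
    then have "z = v" using m_pos by (simp add: mult_le_0_iff)
    then show ?thesis using x by blast
  qed
  then show ?thesis by blast
qed

abbreviation A :: "'a \<Rightarrow> 'a" where
  "A \<equiv> inv_into D B"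

lemma A_in_D: "A v \<in> D"
  by (simp add: B_surj inv_into_into)

lemma B_A: "B (A v) = v"
  by (simp add: B_surj f_inv_into_f)

lemma A_B: "x \<in> D \<Longrightarrow> A (B x) = x"
  by (simp add: B_inj)

text \<open>Linearity and symmetry pass from \<open>B\<close> to its inverse, and the lower bound
  \<open>m\<close> gives the norm bound \<open>1 / m\<close>. From here on \<open>\<Phi>\<close> is
  the calculus of the inverse of \<open>B\<close>.\<close>

sublocale symmetric_operator A
proof
  show "inner (A x) y = inner x (A y)" for x y
    using B_symmetric[OF A_in_D A_in_D, of x y] by (simp add: B_A)
  show "A (x + y) = A x + A y" for x y
    using A_B[of "A x + A y"] subspace_add[OF subspace A_in_D A_in_D]
    by (simp add: B_add A_in_D B_A)
  show "A (c *\<^sub>R x) = c *\<^sub>R A x" for c x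
    using A_B[of "c *\<^sub>R A x"] subspace_scale[OF subspace A_in_D]
    by (simp add: B_scaleR A_in_D B_A)
  show "\<exists>K. \<forall>x. norm (A x) \<le> norm x * K"
    using bounded_below[OF A_in_D] m_pos
    by (intro exI[of _ "1 / m"]) (simp add: B_A field_simps)
qed

end

section \<open>Error bounds for Tikhonov regularization\<close>

lemma continuous_on_abs_powr:
  fixes s :: real
  assumes "s > 0"
  shows "continuous_on S (\<lambda>t::real. \<bar>t\<bar> powr s)"
  using assms by (intro continuous_on_powr' continuous_intros) auto

lemma powr_le_one_plus:
  fixes s c :: real
  assumes "0 \<le> s" "0 \<le> c" "c \<le> 1"
  shows "s powr c \<le> 1 + s"
proof (cases "s \<le> 1")
  case True
  then have "s powr c \<le> 1" using assms by (intro powr_le1) auto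
  then show ?thesis using assms by linarith
next
  case False
  then have "s powr c \<le> s powr 1" using assms by (intro powr_mono) auto
  then show ?thesis using False by simp
qed

text \<open>The operator \<open>\<alpha> (G + \<alpha>)^-1\<close> in the spectral variable
  \<open>t\<close> of the inverse of \<open>B\<close>, in which \<open>G\<close> is
  \<open>\<bar>t\<bar> powr (2 * a + 2)\<close>.\<close>

definition tikhonov_filter :: "real \<Rightarrow> real \<Rightarrow> real \<Rightarrow> real" where
  "tikhonov_filter a \<alpha> t = \<alpha> / (\<bar>t\<bar> powr (2 * a + 2) + \<alpha>)"

lemma continuous_on_tikhonov_filter:
  assumes "a > 0" "\<alpha> > 0"
  shows "continuous_on S (tikhonov_filter a \<alpha>)"
  unfolding tikhonov_filter_def
  using assms by (intro continuous_intros continuous_on_abs_powr)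
    (auto simp: add_nonneg_eq_0_iff)

text \<open>In the variable \<open>s = \<bar>t\<bar> powr (2 * a + 2) / \<alpha>\<close> the filter
  is \<open>1 / (1 + s)\<close> and absorbs growth up to the first power of \<open>s\<close>. The
  growth of \<open>f\<close> has exponent \<open>1 / (2 * a + 2)\<close>; adding
  \<open>kap a\<close> gives \<open>1 / 2\<close>, so both bounds are uniform in
  \<open>t\<close>.\<close>

lemma tikhonov_filter_index_bound:
  assumes "a > 0" "\<alpha> > 0" "R \<ge> 0"
    and bound: "\<bar>f\<bar> \<le> R * max 1 ((\<bar>t\<bar> powr (2 * a + 2) / \<alpha>) powr (1 / (2 * a + 2)))"
  shows "\<bar>tikhonov_filter a \<alpha> t * f\<bar> \<le> R"
    and "\<bar>\<bar>t\<bar> powr a * (tikhonov_filter a \<alpha> t * f)\<bar> \<le> \<alpha> powr kap a * R"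
proof -
  define s where "s = \<bar>t\<bar> powr (2 * a + 2) / \<alpha>"
  let ?b = "1 / (2 * a + 2)"
  have "s \<ge> 0" using assms by (simp add: s_def)
  have filter: "tikhonov_filter a \<alpha> t = 1 / (1 + s)"
    using \<open>\<alpha> > 0\<close> by (simp add: tikhonov_filter_def s_def field_simps)
  have b: "0 \<le> ?b" "?b \<le> 1" and k: "0 \<le> kap a" "kap a \<le> 1" and kb: "kap a + ?b = 1 / 2"
    using \<open>a > 0\<close> by (auto simp: kap_def field_simps)
  have "\<bar>f\<bar> \<le> R * max 1 (s powr ?b)" using bound by (simp add: s_def)
  moreover have "max 1 (s powr ?b) \<le> 1 + s"
    using powr_le_one_plus[OF \<open>s \<ge> 0\<close> b] \<open>s \<ge> 0\<close> by simp
  ultimately have "\<bar>f\<bar> \<le> R * (1 + s)"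
    using \<open>R \<ge> 0\<close> by (meson mult_left_mono order_trans)
  then show "\<bar>tikhonov_filter a \<alpha> t * f\<bar> \<le> R"
    using \<open>s \<ge> 0\<close> by (simp add: filter abs_mult field_simps)
  have "\<bar>t\<bar> powr a = (\<bar>t\<bar> powr (2 * a + 2)) powr kap a"
    using \<open>a > 0\<close> by (simp add: powr_powr kap_def)
  also have "\<dots> = \<alpha> powr kap a * s powr kap a"
    using \<open>\<alpha> > 0\<close> \<open>s \<ge> 0\<close> by (simp add: s_def powr_mult[symmetric])
  finally have ta: "\<bar>t\<bar> powr a = \<alpha> powr kap a * s powr kap a" .
  have "s powr kap a * max 1 (s powr ?b) = max (s powr kap a) (s powr (kap a + ?b))"
    by (simp add: powr_add max_mult_distrib_left)
  also have "\<dots> \<le> 1 + s"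
    unfolding kb using powr_le_one_plus[OF \<open>s \<ge> 0\<close> k] powr_le_one_plus[OF \<open>s \<ge> 0\<close>, of "1/2"] by simp
  finally have "R * (s powr kap a * max 1 (s powr ?b)) \<le> R * (1 + s)"
    using \<open>R \<ge> 0\<close> by (rule mult_left_mono)
  moreover have "s powr kap a * \<bar>f\<bar> \<le> s powr kap a * (R * max 1 (s powr ?b))"
    using \<open>\<bar>f\<bar> \<le> R * max 1 (s powr ?b)\<close> by (intro mult_left_mono) auto
  ultimately have "s powr kap a * \<bar>f\<bar> \<le> R * (1 + s)"
    by (simp add: mult_ac)
  then have "s powr kap a * \<bar>f\<bar> / (1 + s) \<le> R"
    using \<open>s \<ge> 0\<close> by (simp add: divide_le_eq)
  then have "\<alpha> powr kap a * (s powr kap a * \<bar>f\<bar> / (1 + s)) \<le> \<alpha> powr kap a * R"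
    by (intro mult_left_mono) auto
  then show "\<bar>\<bar>t\<bar> powr a * (tikhonov_filter a \<alpha> t * f)\<bar> \<le> \<alpha> powr kap a * R"
    using \<open>s \<ge> 0\<close> by (simp add: filter ta abs_mult mult_ac)
qed

text \<open>Scalar interpolation: applied to \<open>z\<close>, the multipliers \<open>t\<close>,
  \<open>\<bar>t\<bar> powr a * t\<close> and \<open>1\<close> give the norms of order
  \<open>0\<close>, \<open>-a\<close> and \<open>1\<close> of \<open>A z\<close>. It is Young's
  inequality with weights \<open>1 / (a + 1)\<close> and \<open>a / (a + 1)\<close>, where the
  powers of \<open>\<alpha>\<close> are distributed so as to cancel in the product.\<close>

lemma square_le_weighted_mean:
  fixes a \<alpha> t :: real
  assumes "a > 0" "\<alpha> > 0"
  shows "t\<^sup>2 \<le> 1 / (a + 1) * \<alpha> powr (- 2 * kap a) * (\<bar>t\<bar> powr a * t)\<^sup>2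
    + a / (a + 1) * \<alpha> powr (1 - 2 * kap a)"
proof (cases "t = 0")
  case True
  then show ?thesis using assms by simp
next
  case False
  let ?h = "1 / (a + 1)" and ?k = "a / (a + 1)"
  have k: "2 * kap a = ?k" "1 - 2 * kap a = ?h"
    using \<open>a > 0\<close> by (simp_all add: kap_def field_simps)
  have sq: "(\<bar>t\<bar> powr a * t)\<^sup>2 = \<bar>t\<bar> powr (2 * a + 2)"
  proof -
    have "(\<bar>t\<bar> powr a * t)\<^sup>2 = (\<bar>t\<bar> powr a * \<bar>t\<bar>)\<^sup>2" by (simp add: power_mult_distrib)
    also have "\<bar>t\<bar> powr a * \<bar>t\<bar> = \<bar>t\<bar> powr (a + 1)" using False by (simp add: powr_add)
    also have "(\<bar>t\<bar> powr (a + 1))\<^sup>2 = \<bar>t\<bar> powr (2 * a + 2)"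
      using False by (simp add: power2_eq_square powr_add[symmetric])
    finally show ?thesis .
  qed
  have "(\<alpha> powr (- ?k) * \<bar>t\<bar> powr (2 * a + 2)) powr ?h * (\<alpha> powr ?h) powr ?k
      \<le> ?h * (\<alpha> powr (- ?k) * \<bar>t\<bar> powr (2 * a + 2)) + ?k * \<alpha> powr ?h"
    using assms False by (intro Youngs_inequality_0) (auto simp: field_simps)
  also have "(\<alpha> powr (- ?k) * \<bar>t\<bar> powr (2 * a + 2)) powr ?h * (\<alpha> powr ?h) powr ?k
      = (\<alpha> powr (- ?k * ?h) * \<alpha> powr (?h * ?k)) * \<bar>t\<bar> powr ((2 * a + 2) * ?h)"
    by (simp only: powr_mult powr_powr mult_ac)
  also have "\<alpha> powr (- ?k * ?h) * \<alpha> powr (?h * ?k) = 1"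
    using \<open>\<alpha> > 0\<close> by (simp add: powr_add[symmetric])
  also have "(2 * a + 2) * ?h = 2" using \<open>a > 0\<close> by (simp add: field_simps)
  also have "\<bar>t\<bar> powr 2 = t\<^sup>2" using False by simp
  finally show ?thesis
    using k by (simp add: sq mult.assoc)
qed

text \<open>The summands are the coefficients of \<open>H\<close> that arise for \<open>u\<close>,
  for \<open>u / c\<close> and for the extra \<open>H\<close> in the bound on
  \<open>D\<close>.\<close>

definition tikhonov_const :: "real \<Rightarrow> real \<Rightarrow> real" where
  "tikhonov_const c C = (C + 2 / c + 2) + (C + 2 / c + 2) / c + 1"

lemma tikhonov_const_pos:
  assumes "c > 0" "C > 0"
  shows "tikhonov_const c C > 0"
  using assms unfolding tikhonov_const_def by (intro add_pos_pos divide_pos_pos) auto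

text \<open>Completing the square in \<open>u\<close> keeps the coefficient of \<open>\<delta>\<close> equal to \<open>1\<close>.\<close>

lemma tikhonov_residual_bounds:
  fixes u v D H \<delta> c C :: real
  assumes "c > 0" "C > 0" "u \<ge> 0" "v \<ge> 0" "H \<ge> 0" "\<delta> \<ge> 0"
    and min: "u\<^sup>2 + v\<^sup>2 \<le> (\<delta> + C * H)\<^sup>2 + 2 * H * D" and D: "D \<le> (u + \<delta>) / c + H"
  shows "v \<le> max 1 (2 / c) * (\<delta> + tikhonov_const c C * H)"
    and "D \<le> max 1 (2 / c) * (\<delta> + tikhonov_const c C * H)"
proof -
  \<comment> \<open>Completing the square leaves the cross term \<open>2 * H * \<delta> / c\<close>
    and multiples of \<open>H\<^sup>2\<close>; with this \<open>L\<close> the square of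
    \<open>\<delta> + L * H\<close> dominates them.\<close>
  define L where "L = C + 1 / c + 2"
  have "L > 0" using assms by (simp add: L_def add_pos_pos)
  have "2 * H * D \<le> 2 * H * ((u + \<delta>) / c + H)"
    using D \<open>H \<ge> 0\<close> by (intro mult_left_mono) auto
  with min have "(u - H / c)\<^sup>2 + v\<^sup>2 \<le> (\<delta> + C * H)\<^sup>2 + 2 * H * \<delta> / c + 2 * H\<^sup>2 + H\<^sup>2 / c\<^sup>2"
  proof -
    have "(u - H / c)\<^sup>2 = u\<^sup>2 - 2 * H * (u / c) + H\<^sup>2 / c\<^sup>2"
      by (simp add: power2_diff power_divide)
    moreover have "2 * H * ((u + \<delta>) / c + H) = 2 * H * (u / c) + 2 * H * \<delta> / c + 2 * H\<^sup>2"
      by (simp add: add_divide_distrib distrib_left power2_eq_square)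
    ultimately show ?thesis
      using min \<open>2 * H * D \<le> 2 * H * ((u + \<delta>) / c + H)\<close> by linarith
  qed
  also have "\<dots> \<le> (\<delta> + L * H)\<^sup>2"
  proof -
    have "(\<delta> + L * H)\<^sup>2 - ((\<delta> + C * H)\<^sup>2 + 2 * H * \<delta> / c + 2 * H\<^sup>2 + H\<^sup>2 / c\<^sup>2)
      = 4 * \<delta> * H + (2 + 4 * (C + 1 / c) + 2 * (C / c)) * H\<^sup>2"
      using \<open>c > 0\<close> by (simp add: L_def power2_eq_square field_simps)
    moreover have "4 * \<delta> * H + (2 + 4 * (C + 1 / c) + 2 * (C / c)) * H\<^sup>2 \<ge> 0"
      using assms by (intro add_nonneg_nonneg mult_nonneg_nonneg) auto
    ultimately show ?thesis by linarith
  qed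
  finally have le: "(u - H / c)\<^sup>2 + v\<^sup>2 \<le> (\<delta> + L * H)\<^sup>2" .
  have LH: "\<delta> + L * H \<ge> 0" using assms \<open>L > 0\<close> by simp
  have "u - H / c \<le> \<delta> + L * H"
    using le zero_le_power2[of v] by (intro power2_le_imp_le[OF _ LH]) linarith
  then have u: "u \<le> \<delta> + (L + 1 / c) * H" by (simp add: algebra_simps)
  have v: "v \<le> \<delta> + L * H"
    using le zero_le_power2[of "u - H / c"] by (intro power2_le_imp_le[OF _ LH]) linarith
  let ?K = "max 1 (2 / c)" and ?T = "tikhonov_const c C"
  have T: "?T = (L + 1 / c) + (L + 1 / c) / c + 1"
    by (simp add: tikhonov_const_def L_def field_simps)
  have Lc: "(L + 1 / c) / c \<ge> 0" "1 / c \<ge> 0" using \<open>c > 0\<close> \<open>L > 0\<close> by auto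
  have "L * H \<le> ?T * H" using Lc \<open>H \<ge> 0\<close> by (intro mult_right_mono) (auto simp: T)
  with v LH have vT: "v \<le> \<delta> + ?T * H" and "0 \<le> \<delta> + ?T * H" by simp_all
  then have "1 * (\<delta> + ?T * H) \<le> ?K * (\<delta> + ?T * H)"
    by (intro mult_right_mono) auto
  with vT show "v \<le> ?K * (\<delta> + ?T * H)" by simp
  \<comment> \<open>One \<open>\<delta>\<close> comes from \<open>u\<close> and one from the data
    error. This is the origin of the \<open>2 / c\<close> in \<open>max 1 (2 / c)\<close>.\<close>
  have "D \<le> (\<delta> + (L + 1 / c) * H + \<delta>) / c + H"
  proof -
    have "(u + \<delta>) / c \<le> (\<delta> + (L + 1 / c) * H + \<delta>) / c"
      using u \<open>c > 0\<close> by (intro divide_right_mono) auto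
    with D show ?thesis by linarith
  qed
  also have "\<dots> = (2 / c) * \<delta> + ((L + 1 / c) / c + 1) * H"
    using \<open>c > 0\<close> by (simp add: divide_simps) (simp add: algebra_simps)
  also have "\<dots> \<le> ?K * \<delta> + 1 * (?T * H)"
  proof (intro add_mono mult_right_mono)
    show "((L + 1 / c) / c + 1) * H \<le> 1 * (?T * H)"
      using Lc \<open>L > 0\<close> \<open>H \<ge> 0\<close> by (simp add: T mult_right_mono)
  qed (use assms in auto)
  also have "\<dots> \<le> ?K * \<delta> + ?K * (?T * H)"
    using tikhonov_const_pos[of c C] assms by (intro add_mono mult_right_mono) auto
  finally show "D \<le> ?K * (\<delta> + ?T * H)" by (simp add: distrib_left)
qed

context symmetric_operator
begin

lemma norm_spectral_calculus_square:
  assumes f: "continuous_on spec_interval f"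
  shows "(norm (\<Phi> f x))\<^sup>2 = inner (\<Phi> (\<lambda>t. (f t)\<^sup>2) x) x"
  unfolding power2_eq_square[of "f _"] spectral_calculus_mult[OF f f]
    spectral_calculus_symmetric[OF f] power2_norm_eq_inner ..

text \<open>Positivity of the calculus turns a pointwise inequality between squared multipliers into
  one between quadratic forms.\<close>

lemma norm_spectral_calculus_compare:
  assumes f: "continuous_on spec_interval f" and g: "continuous_on spec_interval g"
    and le: "\<And>t. t \<in> spec_interval \<Longrightarrow> (f t)\<^sup>2 \<le> u * (g t)\<^sup>2 + v"
  shows "(norm (\<Phi> f x))\<^sup>2 \<le> u * (norm (\<Phi> g x))\<^sup>2 + v * (norm x)\<^sup>2"
proof -
  have g2: "continuous_on spec_interval (\<lambda>t. (g t)\<^sup>2)" by (intro continuous_intros g)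
  have "0 \<le> inner (\<Phi> (\<lambda>t. (u * (g t)\<^sup>2 + v) - (f t)\<^sup>2) x) x"
    using le by (intro spectral_calculus_nonneg continuous_intros f g) auto
  also have "\<Phi> (\<lambda>t. (u * (g t)\<^sup>2 + v) - (f t)\<^sup>2) x =
      \<Phi> (\<lambda>t. u * (g t)\<^sup>2 + v) x - \<Phi> (\<lambda>t. (f t)\<^sup>2) x"
    by (intro spectral_calculus_diff continuous_intros f g)
  also have "\<Phi> (\<lambda>t. u * (g t)\<^sup>2 + v) x = \<Phi> (\<lambda>t. u * (g t)\<^sup>2) x + \<Phi> (\<lambda>_. v) x"
    by (intro spectral_calculus_add continuous_intros g)
  also have "\<Phi> (\<lambda>t. u * (g t)\<^sup>2) x = u *\<^sub>R \<Phi> (\<lambda>t. (g t)\<^sup>2) x"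
    using spectral_calculus_mult[OF continuous_on_const g2]
    by (simp add: spectral_calculus_const)
  finally show ?thesis
    by (simp add: inner_diff_left inner_add_left norm_spectral_calculus_square[OF f]
        norm_spectral_calculus_square[OF g] spectral_calculus_const power2_norm_eq_inner[of x])
qed

text \<open>For \<open>z = B d\<close> this bounds \<open>norm d\<close> by the norms of order
  \<open>-a\<close> and \<open>1\<close>. The weights are kept because their sum is
  \<open>1\<close>.\<close>

lemma interpolation:
  assumes "a > 0" "\<alpha> > 0"
  shows "(norm (A z))\<^sup>2 \<le> \<alpha> powr (- 2 * kap a) *
    (1 / (a + 1) * (norm (\<Phi> (\<lambda>t. \<bar>t\<bar> powr a) (A z)))\<^sup>2 + a / (a + 1) * (\<alpha> * (norm z)\<^sup>2))"
proof -
  have pa: "continuous_on spec_interval (\<lambda>t. \<bar>t\<bar> powr a)"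
    using continuous_on_abs_powr[OF \<open>a > 0\<close>] .
  have "\<alpha> powr (1 - 2 * kap a) = \<alpha> powr (- 2 * kap a) * \<alpha>"
    using \<open>\<alpha> > 0\<close> powr_add[of \<alpha> "- 2 * kap a" 1] by simp
  moreover have "(norm (\<Phi> (\<lambda>t. t) z))\<^sup>2 \<le>
      (1 / (a + 1) * \<alpha> powr (- 2 * kap a)) * (norm (\<Phi> (\<lambda>t. \<bar>t\<bar> powr a * t) z))\<^sup>2
      + (a / (a + 1) * \<alpha> powr (1 - 2 * kap a)) * (norm z)\<^sup>2"
    using square_le_weighted_mean[OF assms]
    by (intro norm_spectral_calculus_compare continuous_intros pa) (auto simp: mult.assoc)
  moreover have "\<Phi> (\<lambda>t. \<bar>t\<bar> powr a * t) z = \<Phi> (\<lambda>t. \<bar>t\<bar> powr a) (A z)"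
    by (subst spectral_calculus_mult[OF pa continuous_on_id]) (simp add: spectral_calculus_id)
  ultimately show ?thesis
    by (simp add: spectral_calculus_id distrib_left mult_ac)
qed

end

section \<open>Comparison of the Tikhonov minimizer with the auxiliary element\<close>

context bounded_below_self_adjoint
begin

lemma tikhonov_error:
  fixes F :: "'a \<Rightarrow> 'b::real_inner"
  assumes "a > 0" "ca > 0" "Ca > 0" "\<alpha> > 0" "\<delta> \<ge> 0"
    and F: "\<And>x. x \<in> DF \<inter> D \<Longrightarrow>
      ca * neg_scale_norm D B a (x - xdag) \<le> norm (F x - F xdag) \<and>
      norm (F x - F xdag) \<le> Ca * neg_scale_norm D B a (x - xdag)"
    and data: "norm (F xdag - yd) \<le> \<delta>"
    and "xbar \<in> D"
    and min: "is_arg_min (tikhonov F B xbar yd \<alpha>) (\<lambda>x. x \<in> DF \<inter> D) x"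
    and e_def: "e = \<Phi> (tikhonov_filter a \<alpha>) (xdag - xbar)" and DF: "xdag - e \<in> DF"
  shows "norm (x - xdag) \<le> \<delta> / lam a ca \<alpha>
    + max 1 (2 / ca) * tikhonov_const ca Ca * (\<alpha> powr (- kap a) * norm (\<Phi> (\<lambda>t. \<bar>t\<bar> powr a) e))
    + norm e"
proof -
  let ?p = "\<lambda>t::real. \<bar>t\<bar> powr a" and ?r = "tikhonov_filter a \<alpha>" and ?g = "xdag - xbar"
  \<comment> \<open>The multiplier of \<open>B (xh - xbar)\<close>: the function
    \<open>(1 - ?r t) / t\<close>, written without a division by \<open>t\<close> so that it is
    continuous at \<open>0\<close>. That \<open>xh\<close> lies in \<open>D\<close> follows since
    \<open>xh - xbar\<close> is \<open>A\<close> applied to \<open>\<Phi> k ?g\<close>.\<close>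
  define k where "k t = t * (?p t * ?p t / (\<bar>t\<bar> powr (2 * a + 2) + \<alpha>))" for t :: real
  have p: "continuous_on S ?p" for S using continuous_on_abs_powr[OF \<open>a > 0\<close>] .
  have r: "continuous_on S ?r" for S using continuous_on_tikhonov_filter[OF \<open>a > 0\<close> \<open>\<alpha> > 0\<close>] .
  have k: "continuous_on S k" for S
    unfolding k_def using \<open>a > 0\<close> \<open>\<alpha> > 0\<close>
    by (intro continuous_intros continuous_on_abs_powr) (auto simp: add_nonneg_eq_0_iff)
  define H where "H = norm (\<Phi> ?p e)"
  define xh where "xh = xdag - e"
  have pow: "t * t * (?p t * ?p t) = \<bar>t\<bar> powr (2 * a + 2)" for t :: real
  proof (cases "t = 0")
    case False
    have "t * t * (?p t * ?p t) = (\<bar>t\<bar> powr 1 * \<bar>t\<bar> powr 1) * (?p t * ?p t)"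
      using False by simp
    also have "\<dots> = \<bar>t\<bar> powr (2 * a + 2)"
      by (simp only: powr_add[symmetric]) (simp add: algebra_simps)
    finally show ?thesis .
  qed simp
  have "A (\<Phi> k ?g) = \<Phi> (\<lambda>t. t * k t) ?g"
    by (simp add: spectral_calculus_mult[OF continuous_on_id k] spectral_calculus_id)
  also have "\<dots> = \<Phi> (\<lambda>t. 1 - ?r t) ?g"
  proof (rule spectral_calculus_cong)
    fix t :: real
    have "\<bar>t\<bar> powr (2 * a + 2) + \<alpha> > 0" using \<open>\<alpha> > 0\<close> by (simp add: add_nonneg_pos)
    then show "t * k t = 1 - ?r t"
      using pow[of t] by (simp add: k_def tikhonov_filter_def field_simps)
  qed
  also have "\<dots> = ?g - e"
    by (subst spectral_calculus_diff[OF continuous_on_const r])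
      (simp add: spectral_calculus_const e_def)
  finally have Ak: "A (\<Phi> k ?g) = xh - xbar" by (simp add: xh_def)
  have "xh \<in> D"
    using subspace_add[OF subspace A_in_D \<open>xbar \<in> D\<close>, of "\<Phi> k ?g"] by (simp add: Ak)
  then have xh: "xh \<in> DF \<inter> D" using DF by (simp add: xh_def)
  have B_xh: "B (xh - xbar) = \<Phi> k ?g" by (metis Ak B_A)
  have x: "x \<in> DF \<inter> D" and
    le: "tikhonov F B xbar yd \<alpha> x \<le> tikhonov F B xbar yd \<alpha> xh"
    using min xh by (auto simp: is_arg_min_linorder)
  define d where "d = x - xh"
  define z where "z = B d"
  have "d \<in> D" using x xh subspace_diff[OF subspace] by (simp add: d_def)
  then have Az: "A z = d" by (simp add: z_def A_B)
  have xh_xbar: "xh - xbar \<in> D" using xh \<open>xbar \<in> D\<close> subspace_diff[OF subspace] by simp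
  have "B (x - xbar) = z + \<Phi> k ?g"
    using B_add[OF \<open>d \<in> D\<close> xh_xbar] by (simp add: z_def B_xh d_def)
  \<comment> \<open>The normal equation of the linear model: the cross term of the penalty becomes
    an inner product of order \<open>-a\<close>, controlled by \<open>H\<close> and
    \<open>norm (\<Phi> ?p d)\<close>.\<close>
  moreover have inner_eq: "\<alpha> * inner z (\<Phi> k ?g) = inner (\<Phi> ?p d) (\<Phi> ?p e)"
  proof -
    have "inner (\<Phi> ?p d) (\<Phi> ?p e) = inner z (\<Phi> (\<lambda>t. t * (?p t * (?p t * ?r t))) ?g)"
      unfolding Az[symmetric] e_def spectral_calculus_symmetric[OF p] symmetric
      by (simp add: spectral_calculus_mult continuous_on_mult continuous_on_id p r
          spectral_calculus_id)
    also have "(\<lambda>t. t * (?p t * (?p t * ?r t))) = (\<lambda>t. \<alpha> * k t)"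
      by (simp add: k_def tikhonov_filter_def fun_eq_iff)
    also have "\<Phi> (\<lambda>t. \<alpha> * k t) ?g = \<alpha> *\<^sub>R \<Phi> k ?g"
      using spectral_calculus_mult[OF continuous_on_const k] by (simp add: spectral_calculus_const)
    finally show ?thesis by simp
  qed
  moreover have "(norm (z + \<Phi> k ?g))\<^sup>2 =
      (norm z)\<^sup>2 + 2 * inner z (\<Phi> k ?g) + (norm (\<Phi> k ?g))\<^sup>2"
    by (simp add: power2_norm_eq_inner inner_add_left inner_add_right inner_commute)
  ultimately have "\<alpha> * (norm (B (x - xbar)))\<^sup>2 =
      \<alpha> * (norm z)\<^sup>2 + 2 * inner (\<Phi> ?p d) (\<Phi> ?p e) + \<alpha> * (norm (\<Phi> k ?g))\<^sup>2"
    by (simp add: distrib_left)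
  with le have "(norm (F x - yd))\<^sup>2 + \<alpha> * (norm z)\<^sup>2 + 2 * inner (\<Phi> ?p d) (\<Phi> ?p e)
      \<le> (norm (F xh - yd))\<^sup>2"
    by (simp add: tikhonov_def B_xh)
  moreover have "- inner (\<Phi> ?p d) (\<Phi> ?p e) \<le> H * norm (\<Phi> ?p d)"
    using Cauchy_Schwarz_ineq2[of "\<Phi> ?p d" "\<Phi> ?p e"] by (simp add: H_def mult.commute)
  moreover have "(norm (F xh - yd))\<^sup>2 \<le> (\<delta> + Ca * H)\<^sup>2"
  proof (rule power_mono)
    have "neg_scale_norm D B a (xh - xdag) = norm (\<Phi> ?p ((-1) *\<^sub>R e))"
      by (simp add: neg_scale_norm_def neg_power_def xh_def)
    also have "\<dots> = H"
      by (simp only: spectral_calculus_vector_scaleR[OF p]) (simp add: H_def)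
    finally have "norm (F xh - F xdag) \<le> Ca * H" using F[OF xh] by simp
    then show "norm (F xh - yd) \<le> \<delta> + Ca * H"
      using data norm_triangle_ineq[of "F xh - F xdag" "F xdag - yd"] by simp
  qed simp
  ultimately have "(norm (F x - yd))\<^sup>2 + \<alpha> * (norm z)\<^sup>2 \<le>
      (\<delta> + Ca * H)\<^sup>2 + 2 * H * norm (\<Phi> ?p d)"
    by linarith
  then have min': "(norm (F x - yd))\<^sup>2 + (sqrt \<alpha> * norm z)\<^sup>2 \<le>
      (\<delta> + Ca * H)\<^sup>2 + 2 * H * norm (\<Phi> ?p d)"
    using \<open>\<alpha> > 0\<close> by (simp add: power_mult_distrib)
  have D_le: "norm (\<Phi> ?p d) \<le> (norm (F x - yd) + \<delta>) / ca + H"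
  proof -
    have "d = (x - xdag) + e" by (simp add: d_def xh_def)
    then have "norm (\<Phi> ?p d) \<le> norm (\<Phi> ?p (x - xdag)) + H"
      using norm_triangle_ineq by (simp add: spectral_calculus_vector_add[OF p] H_def)
    moreover have "norm (\<Phi> ?p (x - xdag)) \<le> norm (F x - F xdag) / ca"
      using F[OF x] \<open>ca > 0\<close>
      by (simp add: neg_scale_norm_def neg_power_def field_simps)
    moreover have "norm (F x - F xdag) / ca \<le> (norm (F x - yd) + \<delta>) / ca"
      using data norm_triangle_ineq4[of "F x - yd" "F xdag - yd"] \<open>ca > 0\<close>
      by (intro divide_right_mono) auto
    ultimately show ?thesis by linarith
  qed
  define K T where "K = max 1 (2 / ca)" and "T = tikhonov_const ca Ca"
  have KT: "K > 0" "T > 0"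
    using tikhonov_const_pos assms by (auto simp: K_def T_def)
  have "H \<ge> 0" by (simp add: H_def)
  have vb: "sqrt \<alpha> * norm z \<le> K * (\<delta> + T * H)" and Db: "norm (\<Phi> ?p d) \<le> K * (\<delta> + T * H)"
    using tikhonov_residual_bounds[OF \<open>ca > 0\<close> \<open>Ca > 0\<close> _ _ \<open>H \<ge> 0\<close> \<open>\<delta> \<ge> 0\<close> min' D_le] \<open>\<alpha> > 0\<close>
    unfolding K_def T_def by simp_all
  \<comment> \<open>Both terms of the interpolation inequality obey the same bound and their weights
    add up to \<open>1\<close>, so no constant beyond \<open>K\<close> appears and the noise term is
    exactly \<open>\<delta> / lam a ca \<alpha>\<close>.\<close>
  have "norm d \<le> \<alpha> powr (- kap a) * (K * (\<delta> + T * H))"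
  proof (rule power2_le_imp_le)
    let ?X = "(K * (\<delta> + T * H))\<^sup>2"
    have "(norm d)\<^sup>2 \<le> \<alpha> powr (- 2 * kap a) *
        (1 / (a + 1) * (norm (\<Phi> ?p d))\<^sup>2 + a / (a + 1) * (\<alpha> * (norm z)\<^sup>2))"
      using interpolation[OF \<open>a > 0\<close> \<open>\<alpha> > 0\<close>, of z] by (simp only: Az)
    also have "\<alpha> * (norm z)\<^sup>2 = (sqrt \<alpha> * norm z)\<^sup>2"
      using \<open>\<alpha> > 0\<close> by (simp add: power_mult_distrib)
    also have "\<alpha> powr (- 2 * kap a) *
        (1 / (a + 1) * (norm (\<Phi> ?p d))\<^sup>2 + a / (a + 1) * (sqrt \<alpha> * norm z)\<^sup>2)
      \<le> \<alpha> powr (- 2 * kap a) * (1 / (a + 1) * ?X + a / (a + 1) * ?X)"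
      using \<open>a > 0\<close> \<open>\<alpha> > 0\<close> vb Db
      by (intro mult_left_mono add_mono power_mono) auto
    also have "1 / (a + 1) * ?X + a / (a + 1) * ?X = (1 / (a + 1) + a / (a + 1)) * ?X"
      by (simp only: distrib_right)
    also have "1 / (a + 1) + a / (a + 1) = 1"
      using \<open>a > 0\<close> by (simp add: divide_simps)
    also have "\<alpha> powr (- 2 * kap a) * (1 * ?X) = (\<alpha> powr (- kap a) * (K * (\<delta> + T * H)))\<^sup>2"
      using \<open>\<alpha> > 0\<close> by (simp add: power_mult_distrib power2_eq_square[of "\<alpha> powr _"] powr_add[symmetric])
    finally show "(norm d)\<^sup>2 \<le> (\<alpha> powr (- kap a) * (K * (\<delta> + T * H)))\<^sup>2" .
  qed (use KT \<open>H \<ge> 0\<close> \<open>\<delta> \<ge> 0\<close> in auto)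
  also have "\<alpha> powr (- kap a) * (K * (\<delta> + T * H)) =
      \<delta> / lam a ca \<alpha> + K * T * (\<alpha> powr (- kap a) * H)"
    using \<open>\<alpha> > 0\<close> by (simp add: lam_def K_def powr_minus field_simps)
  finally have "norm d \<le> \<delta> / lam a ca \<alpha> + K * T * (\<alpha> powr (- kap a) * H)" .
  moreover have "x - xdag = d - e" by (simp add: d_def xh_def)
  then have "norm (x - xdag) \<le> norm d + norm e"
    using norm_triangle_ineq4 by simp
  ultimately show ?thesis by (simp add: K_def T_def H_def)
qed

text \<open>By the source representation \<open>e\<close> and \<open>\<Phi> ?p e\<close> are
  multipliers applied to \<open>w\<close>, and the pointwise filter bounds estimate both. The bound
  \<open>R * norm w\<close> on \<open>e\<close> also keeps \<open>xdag - e\<close> in the ball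
  inside \<open>DF\<close>.\<close>

lemma tikhonov_rate:
  fixes F :: "'a \<Rightarrow> 'b::real_inner"
  assumes "a > 0" "ca > 0" "Ca > 0" "\<alpha> > 0" "\<delta> \<ge> 0"
    and F: "\<And>x. x \<in> DF \<inter> D \<Longrightarrow>
      ca * neg_scale_norm D B a (x - xdag) \<le> norm (F x - F xdag) \<and>
      norm (F x - F xdag) \<le> Ca * neg_scale_norm D B a (x - xdag)"
    and data: "norm (F xdag - yd) \<le> \<delta>"
    and "xbar \<in> D"
    and min: "is_arg_min (tikhonov F B xbar yd \<alpha>) (\<lambda>x. x \<in> DF \<inter> D) x"
    and source: "xdag - xbar = \<Phi> \<phi> w" and \<phi>: "continuous_on UNIV \<phi>" and "R \<ge> 0"
    and index: "\<And>t. \<bar>\<phi> t\<bar> \<le> R * max 1 ((\<bar>t\<bar> powr (2 * a + 2) / \<alpha>) powr (1 / (2 * a + 2)))"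
    and DF: "cball xdag (R * norm w) \<subseteq> DF"
  shows "norm (x - xdag) \<le> \<delta> / lam a ca \<alpha>
    + (max 1 (2 / ca) * tikhonov_const ca Ca + 1) * (R * norm w)"
proof -
  let ?p = "\<lambda>t::real. \<bar>t\<bar> powr a" and ?r = "tikhonov_filter a \<alpha>"
  define e where "e = \<Phi> ?r (xdag - xbar)"
  have p: "continuous_on S ?p" for S using continuous_on_abs_powr[OF \<open>a > 0\<close>] .
  have r: "continuous_on S ?r" for S using continuous_on_tikhonov_filter[OF \<open>a > 0\<close> \<open>\<alpha> > 0\<close>] .
  have \<phi>I: "continuous_on S \<phi>" for S using \<phi> continuous_on_subset by blast
  have e: "e = \<Phi> (\<lambda>t. ?r t * \<phi> t) w"
    by (simp add: e_def source spectral_calculus_mult r \<phi>I)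
  have norm_e: "norm e \<le> R * norm w"
    unfolding e
    by (intro norm_spectral_calculus_le continuous_intros r \<phi>I
        tikhonov_filter_index_bound(1)[OF \<open>a > 0\<close> \<open>\<alpha> > 0\<close> \<open>R \<ge> 0\<close> index])
  have "\<Phi> ?p e = \<Phi> (\<lambda>t. ?p t * (?r t * \<phi> t)) w"
    by (simp add: e spectral_calculus_mult[OF p] continuous_on_mult r \<phi>I)
  also have "norm \<dots> \<le> \<alpha> powr kap a * R * norm w"
    by (intro norm_spectral_calculus_le continuous_intros p r \<phi>I
        tikhonov_filter_index_bound(2)[OF \<open>a > 0\<close> \<open>\<alpha> > 0\<close> \<open>R \<ge> 0\<close> index])
  finally have "\<alpha> powr (- kap a) * norm (\<Phi> ?p e) \<le> \<alpha> powr (- kap a) * (\<alpha> powr kap a * R * norm w)"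
    by (intro mult_left_mono) auto
  also have "\<dots> = R * norm w"
    using \<open>\<alpha> > 0\<close> by (simp add: powr_minus)
  finally have Pe: "\<alpha> powr (- kap a) * norm (\<Phi> ?p e) \<le> R * norm w" .
  have "xdag - e \<in> DF" using DF norm_e by (auto simp: dist_norm)
  from tikhonov_error[OF assms(1-5) F data \<open>xbar \<in> D\<close> min e_def this]
  have "norm (x - xdag) \<le> \<delta> / lam a ca \<alpha>
    + max 1 (2 / ca) * tikhonov_const ca Ca * (\<alpha> powr (- kap a) * norm (\<Phi> ?p e)) + norm e" .
  also have "\<dots> \<le> \<delta> / lam a ca \<alpha>
    + max 1 (2 / ca) * tikhonov_const ca Ca * (R * norm w) + R * norm w"
    using Pe norm_e tikhonov_const_pos[OF \<open>ca > 0\<close> \<open>Ca > 0\<close>]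
    by (intro add_mono mult_left_mono) auto
  finally show ?thesis by (simp add: algebra_simps)
qed

end

section \<open>The balancing principle\<close>

lemma lam_pos: "\<alpha> > 0 \<Longrightarrow> lam a ca \<alpha> > 0"
  by (simp add: lam_def)

lemma lam_mono:
  assumes "a > 0" "0 < \<alpha>" "\<alpha> \<le> \<beta>"
  shows "lam a ca \<alpha> \<le> lam a ca \<beta>"
  unfolding lam_def using assms
  by (intro divide_right_mono powr_mono2) (auto simp: kap_def)

lemma lam_mult: "q > 0 \<Longrightarrow> \<alpha> > 0 \<Longrightarrow> lam a ca (q * \<alpha>) = q powr kap a * lam a ca \<alpha>"
  by (simp add: lam_def powr_mult)

lemma finite_balancing_set: "finite (balancing_set a ca \<tau> q \<alpha>0 N x \<delta>)"
  by (rule finite_subset[of _ "(\<lambda>k. q ^ k * \<alpha>0) ` {..N}"]) (auto simp: balancing_set_def)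

text \<open>Let \<open>l\<close> be the last grid index whose parameter is at most
  \<open>\<beta>\<close>. Up to \<open>l\<close> the slack in \<open>\<tau>\<close> makes every
  increment acceptable, so the selected index is at least \<open>l\<close>. From \<open>l\<close>
  onwards acceptance itself bounds the increments by a geometric series.\<close>

lemma balancing_bound:
  fixes x :: "real \<Rightarrow> 'a::real_normed_vector"
  assumes "a > 0" "q > 1" and \<tau>: "\<tau> > 1 + q powr (- kap a)" and "\<alpha>0 > 0" "\<delta> > 0"
    and err: "\<And>\<alpha>. 0 < \<alpha> \<Longrightarrow> \<alpha> \<le> \<beta> \<Longrightarrow> norm (x \<alpha> - xdag) \<le> \<delta> / lam a ca \<alpha> + s"
    and s: "2 * s \<le> (\<tau> - (1 + q powr (- kap a))) * (\<delta> / lam a ca \<beta>)"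
    and \<beta>: "\<alpha>0 \<le> \<beta>" "\<beta> < q ^ N * \<alpha>0"
  shows "norm (x (balancing_param a ca \<tau> q \<alpha>0 N x \<delta>) - xdag)
    \<le> (q powr kap a * (1 + \<tau> / (1 - q powr (- kap a))) + \<tau>) * (\<delta> / lam a ca \<beta>)"
proof -
  define al where "al j = q ^ j * \<alpha>0" for j
  define Q where "Q = q powr (- kap a)"
  define G where "G j = \<delta> / lam a ca (al j)" for j
  define g where "g = \<delta> / lam a ca \<beta>"
  have k: "kap a > 0" using \<open>a > 0\<close> by (simp add: kap_def)
  have Q: "0 < Q" "Q < 1" using k \<open>q > 1\<close> by (simp_all add: Q_def powr_less_one)
  have \<tau>Q: "\<tau> > 1 + Q" using \<tau> by (simp add: Q_def)
  have al_pos: "al j > 0" for j using \<open>q > 1\<close> \<open>\<alpha>0 > 0\<close> by (simp add: al_def)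
  have al_mono: "al i \<le> al j \<longleftrightarrow> i \<le> j" for i j
    using \<open>q > 1\<close> \<open>\<alpha>0 > 0\<close> by (simp add: al_def)
  have G_Suc: "G (Suc j) = Q * G j" for j
  proof -
    have "lam a ca (al (Suc j)) = q powr kap a * lam a ca (al j)"
      using lam_mult[of q "al j"] \<open>q > 1\<close> al_pos by (simp add: al_def mult.assoc)
    then show ?thesis by (simp add: G_def Q_def powr_minus divide_inverse mult_ac)
  qed
  have G_pos: "G j > 0" for j using lam_pos[OF al_pos] \<open>\<delta> > 0\<close> by (simp add: G_def)
  have "\<beta> > 0" using \<beta> \<open>\<alpha>0 > 0\<close> by linarith
  have "g > 0" using lam_pos[OF \<open>\<beta> > 0\<close>] \<open>\<delta> > 0\<close> by (simp add: g_def)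
  have g_le: "g \<le> G j" if "al j \<le> \<beta>" for j
    unfolding g_def G_def using lam_mono[OF \<open>a > 0\<close> al_pos that] lam_pos[OF al_pos] \<open>\<delta> > 0\<close>
    by (intro divide_left_mono mult_pos_pos) (auto simp: lam_pos \<open>\<beta> > 0\<close>)
  have le_g: "G j \<le> g" if "\<beta> \<le> al j" for j
    unfolding g_def G_def using lam_mono[OF \<open>a > 0\<close> \<open>\<beta> > 0\<close> that] lam_pos[OF \<open>\<beta> > 0\<close>] \<open>\<delta> > 0\<close>
    by (intro divide_left_mono mult_pos_pos) (auto simp: lam_pos al_pos)
  \<comment> \<open>The first grid index beyond \<open>\<beta>\<close>: it exists because the last
    grid point exceeds \<open>\<beta>\<close>, and it is positive because the grid starts at or
    below \<open>\<beta>\<close>. Its predecessor is \<open>l\<close>.\<close>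
  define n where "n = (LEAST n. \<beta> < al n)"
  have "\<beta> < al N" using \<beta> by (simp add: al_def)
  then have n: "\<beta> < al n" "n \<le> N"
    unfolding n_def by (fact LeastI, fact Least_le)
  have "n \<noteq> 0"
  proof
    assume "n = 0"
    then show False using n(1) \<beta> by (simp add: al_def)
  qed
  then obtain l where l: "n = Suc l" using not0_implies_Suc by blast
  have "\<not> \<beta> < al l" using not_less_Least[of l "\<lambda>n. \<beta> < al n"] l by (simp add: n_def)
  then have al_l: "al l \<le> \<beta>" by simp
  \<comment> \<open>One grid step further the noise term is already at most \<open>g\<close>, and
    that step changes it only by the factor \<open>Q\<close>.\<close>
  have G_l: "G l \<le> q powr kap a * g"
  proof -
    have "Q * G l \<le> g" using le_g[of "Suc l"] n l by (simp add: G_Suc)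
    then show ?thesis using \<open>q > 1\<close> by (simp add: Q_def powr_minus field_simps)
  qed
  let ?H = "balancing_set a ca \<tau> q \<alpha>0 N x \<delta>"
  have H: "?H = {al k |k. k \<le> N \<and> (\<forall>j\<in>{1..k}. norm (x (al j) - x (al (j - 1))) \<le> \<tau> * G (j - 1))}"
    by (simp add: balancing_set_def al_def G_def)
  have "norm (x (al j) - x (al (j - 1))) \<le> \<tau> * G (j - 1)" if "j \<in> {1..l}" for j
  proof -
    have "j \<noteq> 0" using that by simp
    then obtain i where i: "j = Suc i" using not0_implies_Suc by blast
    have le: "al j \<le> \<beta>" "al i \<le> \<beta>" using al_mono[of j l] al_mono[of i l] al_l that i by auto
    have "norm (x (al j) - x (al i)) \<le> norm (x (al j) - xdag) + norm (x (al i) - xdag)"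
      using norm_triangle_ineq4[of "x (al j) - xdag" "x (al i) - xdag"] by simp
    also have "\<dots> \<le> (G j + s) + (G i + s)"
      unfolding G_def by (intro add_mono err al_pos le)
    \<comment> \<open>The noise terms are \<open>Q * G i\<close> and \<open>G i\<close>; the surplus
      of \<open>\<tau>\<close> over \<open>1 + Q\<close> takes in \<open>2 * s\<close>.\<close>
    also have "\<dots> \<le> (1 + Q) * G i + (\<tau> - (1 + Q)) * g"
      using s by (simp add: i G_Suc g_def Q_def algebra_simps)
    also have "\<dots> \<le> (1 + Q) * G i + (\<tau> - (1 + Q)) * G i"
      using \<tau>Q g_le[OF le(2)] by (intro add_left_mono mult_left_mono) auto
    finally show ?thesis by (simp add: i algebra_simps)
  qed
  then have "al l \<in> ?H" unfolding H using n l by auto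
  then have "Max ?H \<in> ?H" "al l \<le> Max ?H"
    using finite_balancing_set by (auto intro!: Max_in Max_ge)
  then obtain k where k: "Max ?H = al k" "l \<le> k"
    and steps: "\<And>j. j \<in> {1..k} \<Longrightarrow> norm (x (al j) - x (al (j - 1))) \<le> \<tau> * G (j - 1)"
    unfolding H using al_mono by auto
  \<comment> \<open>Telescoping sum of the accepted increments, with the partial geometric sums in
    closed form.\<close>
  have tele: "norm (x (al (l + i)) - x (al l)) \<le> \<tau> * G l * ((1 - Q ^ i) / (1 - Q))" if "l + i \<le> k" for i
    using that
  proof (induction i)
    case 0
    then show ?case by simp
  next
    case (Suc i)
    have G_i: "G (l + i) = Q ^ i * G l" by (induction i) (simp_all add: G_Suc)
    have "norm (x (al (l + Suc i)) - x (al l)) \<le>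
        norm (x (al (Suc (l + i))) - x (al (l + i))) + norm (x (al (l + i)) - x (al l))"
      using norm_triangle_ineq[of "x (al (Suc (l + i))) - x (al (l + i))" "x (al (l + i)) - x (al l)"]
      by simp
    also have "\<dots> \<le> \<tau> * G (l + i) + \<tau> * G l * ((1 - Q ^ i) / (1 - Q))"
      using steps[of "Suc (l + i)"] Suc by (intro add_mono) auto
    also have "\<dots> = \<tau> * G l * (Q ^ i + (1 - Q ^ i) / (1 - Q))"
      unfolding G_i by (simp add: algebra_simps)
    also have "Q ^ i + (1 - Q ^ i) / (1 - Q) = (1 - Q ^ Suc i) / (1 - Q)"
      using Q by (simp add: field_simps)
    finally show ?case .
  qed
  have "norm (x (al k) - x (al l)) \<le> \<tau> * G l * ((1 - Q ^ (k - l)) / (1 - Q))"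
    using tele[of "k - l"] \<open>l \<le> k\<close> by simp
  also have "\<dots> \<le> \<tau> * G l * (1 / (1 - Q))"
    using Q \<tau>Q G_pos[of l] by (intro mult_left_mono divide_right_mono) auto
  finally have "norm (x (al k) - x (al l)) \<le> G l * (\<tau> / (1 - Q))"
    by (simp add: mult_ac)
  moreover have "norm (x (al l) - xdag) \<le> G l + s"
    unfolding G_def by (intro err al_pos al_l)
  moreover have "norm (x (al k) - xdag) \<le> norm (x (al k) - x (al l)) + norm (x (al l) - xdag)"
    using norm_triangle_ineq[of "x (al k) - x (al l)" "x (al l) - xdag"] by simp
  ultimately have "norm (x (al k) - xdag) \<le> G l * (1 + \<tau> / (1 - Q)) + s"
    by (simp add: algebra_simps)
  also have "G l * (1 + \<tau> / (1 - Q)) \<le> (q powr kap a * g) * (1 + \<tau> / (1 - Q))"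
    using G_l Q \<tau>Q by (intro mult_right_mono) auto
  also have "s \<le> \<tau> * g"
  proof -
    have "2 * s \<le> (\<tau> - (1 + Q)) * g" using s by (simp add: g_def Q_def)
    also have "\<dots> \<le> \<tau> * g" using Q \<open>g > 0\<close> by (intro mult_right_mono) auto
    finally show ?thesis using \<tau>Q Q \<open>g > 0\<close> mult_pos_pos[of \<tau> g] by linarith
  qed
  finally show ?thesis
    by (simp add: balancing_param_def k g_def[symmetric] Q_def[symmetric] algebra_simps)
qed

text \<open>
  There are parameters \<open>s \<delta>\<close> at which the approximation error \<open>\<rho>\<close> is at most \<open>\<epsilon>\<close> times the propagated
  noise \<open>\<delta> / s \<delta> powr \<kappa>\<close>, which in turn is of the order of \<open>rate\<close>.
\<close>

definition admits_parameter_choice :: "real \<Rightarrow> (real \<Rightarrow> real) \<Rightarrow> (real \<Rightarrow> real) \<Rightarrow> bool" where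
  "admits_parameter_choice \<kappa> \<rho> rate \<longleftrightarrow>
    (\<forall>\<epsilon>>0. \<exists>s C. (s \<longlongrightarrow> 0) (at_right 0) \<and>
      (\<forall>\<^sub>F \<delta> in at_right 0. 0 < s \<delta> \<and> \<rho> (s \<delta>) * s \<delta> powr \<kappa> \<le> \<epsilon> * \<delta> \<and> \<delta> / s \<delta> powr \<kappa> \<le> C * rate \<delta>))"

text \<open>The parameter \<open>s \<delta>\<close> serves as the threshold \<open>\<beta>\<close>
  of \<open>balancing_bound\<close>. Since \<open>s\<close> and \<open>rate\<close> tend to
  \<open>0\<close>, it eventually lies between the ends of the grid and below
  \<open>\<alpha>1\<close>.\<close>

lemma balancing_rate:
  fixes x :: "real \<Rightarrow> real \<Rightarrow> 'a::real_normed_vector"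
  assumes "a > 0" "q > 1" and \<tau>: "\<tau> > 1 + q powr (- kap a)"
    and "\<delta>0 > 0" "c5 > 0" "c6 > 0" "E \<ge> 0" "\<alpha>1 > 0"
    and \<alpha>0: "\<And>\<delta>. 0 < \<delta> \<Longrightarrow> \<delta> \<le> \<delta>0 \<Longrightarrow> 0 < \<alpha>0 \<delta> \<and> \<alpha>0 \<delta> \<le> c5 * \<delta> powr (1 / kap a)"
    and \<alpha>N: "\<And>\<delta>. 0 < \<delta> \<Longrightarrow> \<delta> \<le> \<delta>0 \<Longrightarrow> c6 \<le> q ^ N \<delta> * \<alpha>0 \<delta>"
    and err: "\<And>\<delta> \<alpha>. 0 < \<delta> \<Longrightarrow> \<delta> \<le> \<delta>0 \<Longrightarrow> 0 < \<alpha> \<Longrightarrow> \<alpha> \<le> \<alpha>1 \<Longrightarrow>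
      norm (x \<delta> \<alpha> - xdag) \<le> \<delta> / lam a ca \<alpha> + E * \<rho> \<alpha>"
    and \<rho>_mono: "\<And>\<alpha> \<beta>. 0 < \<alpha> \<Longrightarrow> \<alpha> \<le> \<beta> \<Longrightarrow> \<rho> \<alpha> \<le> \<rho> \<beta>"
    and choice: "admits_parameter_choice (kap a) \<rho> rate"
    and rate: "(rate \<longlongrightarrow> 0) (at_right 0)"
  shows "(\<lambda>\<delta>. norm (x \<delta> (balancing_param a ca \<tau> q (\<alpha>0 \<delta>) (N \<delta>) (x \<delta>) \<delta>) - xdag))
    \<in> O[at_right 0](rate)"
proof -
  have k: "kap a > 0" using \<open>a > 0\<close> by (simp add: kap_def)
  define K where "K = max 1 (2 / ca)"
  have "K \<ge> 1" by (simp add: K_def)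
  define \<theta> where "\<theta> = \<tau> - (1 + q powr (- kap a))"
  have "\<theta> > 0" using \<tau> by (simp add: \<theta>_def)
  \<comment> \<open>Chosen so that \<open>2 * E * \<epsilon> \<le> \<theta>\<close>: twice the
    approximation error fits into the slack. The added \<open>1\<close> covers
    \<open>E = 0\<close>.\<close>
  define \<epsilon> where "\<epsilon> = \<theta> / (2 * (E + 1))"
  have "\<epsilon> > 0" using \<open>\<theta> > 0\<close> \<open>E \<ge> 0\<close> by (simp add: \<epsilon>_def)
  then obtain s C where s: "(s \<longlongrightarrow> 0) (at_right 0)"
    and s_props: "\<forall>\<^sub>F \<delta> in at_right 0. 0 < s \<delta> \<and> \<rho> (s \<delta>) * s \<delta> powr kap a \<le> \<epsilon> * \<delta>
      \<and> \<delta> / s \<delta> powr kap a \<le> C * rate \<delta>"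
    using choice unfolding admits_parameter_choice_def by blast
  define M where "M = (q powr kap a * (1 + \<tau> / (1 - q powr (- kap a))) + \<tau>) * K"
  have "q powr (- kap a) < 1" using k \<open>q > 1\<close> by (simp add: powr_less_one)
  moreover have "\<tau> > 0" using \<tau> powr_ge_zero[of q "- kap a"] by linarith
  ultimately have "M \<ge> 0" unfolding M_def using \<open>K \<ge> 1\<close> by (intro mult_nonneg_nonneg add_nonneg_nonneg) auto
  have "\<forall>\<^sub>F \<delta> in at_right 0. s \<delta> < min c6 \<alpha>1"
    using s \<open>c6 > 0\<close> \<open>\<alpha>1 > 0\<close> by (intro order_tendstoD(2)) auto
  moreover have "\<forall>\<^sub>F \<delta> in at_right 0. C * rate \<delta> < c5 powr (- kap a)"
  proof (rule order_tendstoD(2))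
    show "((\<lambda>\<delta>. C * rate \<delta>) \<longlongrightarrow> C * 0) (at_right 0)" by (intro tendsto_intros rate)
  qed (use \<open>c5 > 0\<close> in simp)
  moreover have "\<forall>\<^sub>F \<delta> in at_right 0. 0 < \<delta> \<and> \<delta> \<le> \<delta>0"
    using \<open>\<delta>0 > 0\<close> unfolding eventually_at_right_field by (intro exI[of _ \<delta>0]) auto
  ultimately have "\<forall>\<^sub>F \<delta> in at_right 0.
    norm (x \<delta> (balancing_param a ca \<tau> q (\<alpha>0 \<delta>) (N \<delta>) (x \<delta>) \<delta>) - xdag) \<le> (M * C) * rate \<delta>"
    using s_props
  proof eventually_elim
    case (elim \<delta>)
    then have \<delta>: "0 < \<delta>" "\<delta> \<le> \<delta>0" and "s \<delta> < c6" "s \<delta> < \<alpha>1" "s \<delta> > 0" by auto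
    have pow_pos: "s \<delta> powr kap a > 0" using \<open>s \<delta> > 0\<close> by simp
    have lam_s: "\<delta> / lam a ca (s \<delta>) = K * (\<delta> / s \<delta> powr kap a)"
      by (simp add: lam_def K_def)
    have "\<rho> (s \<delta>) \<le> \<epsilon> * (\<delta> / s \<delta> powr kap a)"
      using elim pow_pos by (simp add: field_simps)
    then have "2 * (E * \<rho> (s \<delta>)) \<le> 2 * (E * (\<epsilon> * (\<delta> / s \<delta> powr kap a)))"
      using \<open>E \<ge> 0\<close> by (intro mult_left_mono) auto
    also have "\<dots> = (2 * E * \<epsilon>) * (\<delta> / s \<delta> powr kap a)" by simp
    also have "\<dots> \<le> (\<theta> * K) * (\<delta> / s \<delta> powr kap a)"
    proof (rule mult_right_mono)
      have "2 * E * \<epsilon> = \<theta> * (E / (E + 1))" using \<open>E \<ge> 0\<close> by (simp add: \<epsilon>_def field_simps)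
      also have "\<dots> \<le> \<theta> * K"
        using \<open>E \<ge> 0\<close> \<open>\<theta> > 0\<close> \<open>K \<ge> 1\<close> by (intro mult_left_mono) (auto intro: order_trans[of _ 1])
      finally show "2 * E * \<epsilon> \<le> \<theta> * K" .
    qed (use \<delta> in simp)
    finally have small: "2 * (E * \<rho> (s \<delta>)) \<le> \<theta> * (\<delta> / lam a ca (s \<delta>))"
      by (simp add: lam_s)
    \<comment> \<open>Eventually \<open>C * rate \<delta>\<close> is below
      \<open>c5 powr (- kap a)\<close>, which puts the upper bound for
      \<open>\<alpha>0 \<delta>\<close> below \<open>s \<delta>\<close>.\<close>
    have start: "\<alpha>0 \<delta> \<le> s \<delta>"
    proof -
      have "\<delta> / s \<delta> powr kap a < c5 powr (- kap a)" using elim by linarith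
      then have "c5 powr kap a * \<delta> < s \<delta> powr kap a"
        using pow_pos \<open>c5 > 0\<close> by (simp add: powr_minus field_simps)
      also have "c5 powr kap a * \<delta> = (c5 * \<delta> powr (1 / kap a)) powr kap a"
        using \<open>c5 > 0\<close> k \<delta> by (simp add: powr_mult powr_powr)
      finally have "c5 * \<delta> powr (1 / kap a) < s \<delta>"
        using powr_less_cancel2[OF k _ _] \<open>c5 > 0\<close> \<open>s \<delta> > 0\<close> \<delta> by simp
      then show ?thesis using \<alpha>0[OF \<delta>] by linarith
    qed
    have "norm (x \<delta> (balancing_param a ca \<tau> q (\<alpha>0 \<delta>) (N \<delta>) (x \<delta>) \<delta>) - xdag)
        \<le> (q powr kap a * (1 + \<tau> / (1 - q powr (- kap a))) + \<tau>) * (\<delta> / lam a ca (s \<delta>))"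
    proof (rule balancing_bound[OF \<open>a > 0\<close> \<open>q > 1\<close> \<tau> _ \<open>0 < \<delta>\<close> _ _ start])
      show "norm (x \<delta> \<alpha> - xdag) \<le> \<delta> / lam a ca \<alpha> + E * \<rho> (s \<delta>)" if "0 < \<alpha>" "\<alpha> \<le> s \<delta>" for \<alpha>
      proof -
        have "norm (x \<delta> \<alpha> - xdag) \<le> \<delta> / lam a ca \<alpha> + E * \<rho> \<alpha>"
          using \<open>s \<delta> < \<alpha>1\<close> that by (intro err \<delta>) auto
        also have "\<dots> \<le> \<delta> / lam a ca \<alpha> + E * \<rho> (s \<delta>)"
          using \<rho>_mono[OF that] \<open>E \<ge> 0\<close> by (intro add_left_mono mult_left_mono) auto
        finally show ?thesis .
      qed
      show "s \<delta> < q ^ N \<delta> * \<alpha>0 \<delta>" using \<alpha>N[OF \<delta>] \<open>s \<delta> < c6\<close> by linarith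
    qed (use \<alpha>0[OF \<delta>] small in \<open>auto simp: \<theta>_def\<close>)
    also have "\<dots> = M * (\<delta> / s \<delta> powr kap a)"
      by (simp add: lam_s M_def)
    also have "\<dots> \<le> M * (C * rate \<delta>)"
      using elim \<open>M \<ge> 0\<close> by (intro mult_left_mono) auto
    finally show ?case by simp
  qed
  \<comment> \<open>The sign of \<open>C\<close> is not prescribed, hence the absolute
    value.\<close>
  then show ?thesis
    by (intro bigoI[of _ "\<bar>M * C\<bar>"]) (auto elim!: eventually_mono simp: abs_mult[symmetric] intro: order_trans[OF _ abs_ge_self])
qed

section \<open>Power-type and logarithmic source conditions\<close>

lemma log_index_mono:
  assumes "\<mu> > 0" "K > 0" "u \<le> v"
  shows "log_index K \<mu> u \<le> log_index K \<mu> v"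
proof -
  have inner: "K * ln (1 / u) powr (- \<mu>) \<le> K * ln (1 / v) powr (- \<mu>)"
    if "0 < u" "u \<le> v" "v \<le> exp (- 1)" for u v
  proof -
    have "ln v \<le> ln (exp (- 1))" using that by (subst ln_le_cancel_iff) auto
    then have "1 \<le> ln (1 / v)" using that by (simp add: ln_div)
    moreover have "ln (1 / v) \<le> ln (1 / u)" using that by (simp add: ln_div)
    ultimately show ?thesis
      using assms by (intro mult_left_mono powr_mono2') auto
  qed
  have "ln (1 / exp (- 1 :: real)) = 1" by (simp add: ln_div)
  then have "K * ln (1 / u) powr (- \<mu>) \<le> K" if "0 < u" "u \<le> exp (- 1)" for u
    using inner[OF that order_refl] by simp
  then show ?thesis
    using assms inner[of u v] by (auto simp: log_index_def)
qed

lemma log_index_nonneg: "K > 0 \<Longrightarrow> log_index K \<mu> t \<ge> 0"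
  by (simp add: log_index_def)

lemma tendsto_log_powr_at_right_0:
  assumes "\<mu> > 0"
  shows "((\<lambda>t::real. ln (1 / t) powr (- \<mu>)) \<longlongrightarrow> 0) (at_right 0)"
proof -
  have "filterlim (\<lambda>t::real. ln (1 / t)) at_top (at_right 0)"
    by (rule filterlim_compose[OF ln_at_top])
      (simp add: filterlim_inverse_at_top_right flip: inverse_eq_divide)
  then show ?thesis
    using assms by (intro tendsto_neg_powr) auto
qed

lemma tendsto_log_index:
  assumes "\<mu> > 0"
  shows "(log_index K \<mu> \<longlongrightarrow> 0) (at_right 0)"
proof (rule Lim_transform_eventually)
  show "((\<lambda>t. K * ln (1 / t) powr (- \<mu>)) \<longlongrightarrow> 0) (at_right 0)"
    using tendsto_mult_left[OF tendsto_log_powr_at_right_0[OF assms], of K] by simp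
  show "\<forall>\<^sub>F t in at_right 0. K * ln (1 / t) powr (- \<mu>) = log_index K \<mu> t"
    unfolding eventually_at_right_field
    by (intro exI[of _ "exp (- 1)"]) (auto simp: log_index_def)
qed

text \<open>Three closed pieces are glued. The delicate point is \<open>0\<close>, where the
  logarithm is unbounded and its negative power tends to \<open>0\<close>.\<close>

lemma continuous_log_index:
  assumes "\<mu> > 0"
  shows "continuous_on UNIV (log_index K \<mu>)"
proof -
  have neg: "continuous_on {..0} (log_index K \<mu>)"
    by (rule continuous_on_eq[of _ "\<lambda>_. 0"]) (auto simp: log_index_def)
  have mid: "continuous_on {0..exp (- 1)} (log_index K \<mu>)"
    unfolding continuous_on
  proof
    fix t :: real assume t: "t \<in> {0..exp (- 1)}"
    show "(log_index K \<mu> \<longlongrightarrow> log_index K \<mu> t) (at t within {0..exp (- 1)})"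
    proof (cases "t = 0")
      case True
      then show ?thesis
        using tendsto_log_index[OF assms, of K] by (simp add: at_within_Icc_at_right log_index_def)
    next
      case False
      then have "t > 0" using t by auto
      have "ln t \<le> ln (exp (- 1))" using t \<open>t > 0\<close> by (subst ln_le_cancel_iff) auto
      moreover have "ln (1 / t) = - ln t" using \<open>t > 0\<close> by (simp add: ln_div)
      ultimately have "ln (1 / t) > 0" using ln_exp[of "- 1 :: real"] by linarith
      then have "((\<lambda>t. K * ln (1 / t) powr (- \<mu>)) \<longlongrightarrow> K * ln (1 / t) powr (- \<mu>))
          (at t within {0..exp (- 1)})"
        using \<open>t > 0\<close> by (intro tendsto_intros) auto
      moreover have "\<forall>\<^sub>F u in at t within {0..exp (- 1)}. K * ln (1 / u) powr (- \<mu>) = log_index K \<mu> u"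
        using \<open>t > 0\<close> unfolding eventually_at
        by (intro exI[of _ t]) (auto simp: log_index_def dist_real_def)
      ultimately have "(log_index K \<mu> \<longlongrightarrow> K * ln (1 / t) powr (- \<mu>))
          (at t within {0..exp (- 1)})"
        by (rule Lim_transform_eventually)
      then show ?thesis using t \<open>t > 0\<close> by (simp add: log_index_def)
    qed
  qed
  have pos: "continuous_on {exp (- 1)..} (log_index K \<mu>)"
  proof (rule continuous_on_eq[of _ "\<lambda>_. K"])
    show "K = log_index K \<mu> t" if "t \<in> {exp (- 1)..}" for t
    proof -
      have "t > 0" using that less_le_trans[OF exp_gt_zero] by simp
      then show ?thesis
        using that by (cases "t = exp (- 1)") (auto simp: log_index_def ln_div)
    qed
  qed simp
  have "{..0} \<union> ({0..exp (- 1)} \<union> {exp (- 1)..}) = (UNIV :: real set)"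
    by auto
  then show ?thesis
    using continuous_on_closed_Un[OF _ _ neg continuous_on_closed_Un[OF _ _ mid pos]]
    by (simp add: closed_Un)
qed

text \<open>The inequality \<open>ln r \<le> r - 1\<close> is used at
  \<open>r = s powr (b / \<mu>)\<close>; raising the result to the power \<open>\<mu>\<close>
  restores the exponent \<open>b\<close>.\<close>

lemma one_plus_ln_powr_le:
  fixes s b \<mu> :: real
  assumes "b > 0" "\<mu> > 0" "s \<ge> 1"
  shows "(1 + ln s) powr \<mu> \<le> (1 + \<mu> / b) powr \<mu> * s powr b"
proof -
  define c where "c = b / \<mu>"
  have "c > 0" using assms by (simp add: c_def)
  have "s powr c \<ge> 1" using \<open>c > 0\<close> assms by (intro ge_one_powr_ge_zero) auto
  have "c * ln s \<le> s powr c - 1"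
    using ln_le_minus_one[of "s powr c"] assms by (simp add: ln_powr)
  then have "ln s \<le> (s powr c - 1) / c" using \<open>c > 0\<close> by (simp add: field_simps)
  also have "\<dots> \<le> s powr c / c" using \<open>c > 0\<close> by (intro divide_right_mono) auto
  finally have "1 + ln s \<le> (1 + 1 / c) * s powr c"
    using \<open>s powr c \<ge> 1\<close> by (simp add: algebra_simps)
  then have "(1 + ln s) powr \<mu> \<le> ((1 + 1 / c) * s powr c) powr \<mu>"
    using assms by (intro powr_mono2) auto
  also have "\<dots> = (1 + 1 / c) powr \<mu> * s powr (c * \<mu>)"
    using \<open>c > 0\<close> by (simp add: powr_mult powr_powr)
  finally show ?thesis using assms by (simp add: c_def)
qed

text \<open>Up to \<open>\<alpha>\<close> monotonicity suffices; beyond it the ratio of the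
  logarithms grows more slowly than any power of \<open>u / \<alpha>\<close>. The constant sits in
  the first argument so that the dominating function is again a \<open>log_index\<close>.\<close>

lemma log_index_le:
  assumes "\<mu> > 0" "K > 0" "b > 0" "0 < \<alpha>" "\<alpha> \<le> exp (- 1)"
  shows "log_index K \<mu> u \<le> log_index ((1 + \<mu> / b) powr \<mu> * K) \<mu> \<alpha> * max 1 ((u / \<alpha>) powr b)"
proof -
  define C where "C = (1 + \<mu> / b) powr \<mu>"
  have "C \<ge> 1" unfolding C_def using assms by (intro ge_one_powr_ge_zero) auto
  have scale: "log_index (C * K) \<mu> \<alpha> = C * log_index K \<mu> \<alpha>"
    by (simp add: log_index_def)
  have ge: "log_index K \<mu> \<alpha> \<ge> 0" using log_index_nonneg[OF \<open>K > 0\<close>] .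
  have "log_index K \<mu> u \<le> C * log_index K \<mu> \<alpha> * max 1 ((u / \<alpha>) powr b)"
  proof (cases "u \<le> \<alpha>")
    case True
    have "log_index K \<mu> u \<le> 1 * log_index K \<mu> \<alpha> * 1"
      using log_index_mono[OF assms(1,2) True] by simp
    also have "\<dots> \<le> C * log_index K \<mu> \<alpha> * max 1 ((u / \<alpha>) powr b)"
      using \<open>C \<ge> 1\<close> ge by (intro mult_mono) auto
    finally show ?thesis .
  next
    case False
    \<comment> \<open>Truncation leaves the value of \<open>log_index\<close> unchanged, since it is
      constant beyond \<open>exp (- 1)\<close>, and ensures \<open>l \<ge> 1\<close>.\<close>
    define v where "v = min u (exp (- 1))"
    have v: "\<alpha> \<le> v" "v \<le> exp (- 1)" "v > 0" using False assms by (auto simp: v_def)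
    define l where "l = ln (1 / v)"
    have "ln v \<le> ln (exp (- 1))" using v by (subst ln_le_cancel_iff) auto
    then have l: "l \<ge> 1" using v by (simp add: l_def ln_div)
    have "v / \<alpha> \<ge> 1" using v assms by simp
    have la: "ln (1 / \<alpha>) = l + ln (v / \<alpha>)" using v assms by (simp add: l_def ln_div)
    \<comment> \<open>As \<open>l \<ge> 1\<close>, the sum is bounded by a product, which the power
      \<open>\<mu>\<close> splits.\<close>
    also have "\<dots> \<le> l * (1 + ln (v / \<alpha>))"
      using mult_right_mono[OF l ln_ge_zero[OF \<open>v / \<alpha> \<ge> 1\<close>]] by (simp add: algebra_simps)
    finally have le: "ln (1 / \<alpha>) \<le> l * (1 + ln (v / \<alpha>))" .
    have la1: "ln (1 / \<alpha>) \<ge> 1" using la l ln_ge_zero[OF \<open>v / \<alpha> \<ge> 1\<close>] by linarith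
    have "ln (1 / \<alpha>) powr \<mu> \<le> (l * (1 + ln (v / \<alpha>))) powr \<mu>"
      by (intro powr_mono2; use le la1 assms in linarith)
    also have "\<dots> = l powr \<mu> * (1 + ln (v / \<alpha>)) powr \<mu>"
      using l ln_ge_zero[OF \<open>v / \<alpha> \<ge> 1\<close>] by (simp add: powr_mult)
    also have "\<dots> \<le> l powr \<mu> * (C * (v / \<alpha>) powr b)"
      unfolding C_def using one_plus_ln_powr_le[OF \<open>b > 0\<close> \<open>\<mu> > 0\<close> \<open>v / \<alpha> \<ge> 1\<close>]
      by (intro mult_left_mono) auto
    finally have main: "l powr (- \<mu>) \<le> ln (1 / \<alpha>) powr (- \<mu>) * (C * (v / \<alpha>) powr b)"
      using l la1 by (simp add: powr_minus field_simps)
    have "log_index K \<mu> u = K * l powr (- \<mu>)"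
    proof (cases "u \<le> exp (- 1)")
      case True
      then show ?thesis using v by (simp add: log_index_def l_def v_def min_def)
    next
      case False
      then have "u > 0" using exp_gt_zero[of "- 1 :: real"] by linarith
      then show ?thesis using False by (simp add: log_index_def l_def v_def ln_div)
    qed
    also have "\<dots> \<le> K * (ln (1 / \<alpha>) powr (- \<mu>) * (C * (v / \<alpha>) powr b))"
      using main \<open>K > 0\<close> by (intro mult_left_mono) auto
    also have "\<dots> = C * log_index K \<mu> \<alpha> * (v / \<alpha>) powr b"
      using assms by (simp add: log_index_def)
    also have "\<dots> \<le> C * log_index K \<mu> \<alpha> * max 1 ((u / \<alpha>) powr b)"
    proof (rule mult_left_mono)
      have "(v / \<alpha>) powr b \<le> (u / \<alpha>) powr b"
        using v assms by (intro powr_mono2 divide_right_mono) (auto simp: v_def)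
      then show "(v / \<alpha>) powr b \<le> max 1 ((u / \<alpha>) powr b)" by simp
    qed (use \<open>C \<ge> 1\<close> ge in simp)
    finally show ?thesis .
  qed
  then show ?thesis by (simp add: scale[unfolded C_def] C_def)
qed

section \<open>Parameter choices for the two types of index functions\<close>

lemma tendsto_powr_at_right_0:
  fixes c :: real
  assumes "c > 0"
  shows "((\<lambda>\<delta>::real. \<delta> powr c) \<longlongrightarrow> 0) (at_right 0)"
proof -
  have "((\<lambda>\<delta>::real. \<delta> powr c) \<longlongrightarrow> 0 powr c) (at_right 0)"
    using assms by (intro tendsto_powr2 tendsto_const tendsto_ident_at)
      (auto simp: eventually_at_filter)
  then show ?thesis by simp
qed

text \<open>The choice \<open>s \<delta> = (\<epsilon> * \<delta>) powr (1 / (b + \<kappa>))\<close>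
  solves the balance \<open>s \<delta> powr (b + \<kappa>) = \<epsilon> * \<delta>\<close>
  exactly.\<close>

lemma admits_parameter_choice_power:
  assumes "\<kappa> > 0" "b > 0"
  shows "admits_parameter_choice \<kappa> (\<lambda>\<alpha>. \<alpha> powr b) (\<lambda>\<delta>. \<delta> powr (b / (b + \<kappa>)))"
  unfolding admits_parameter_choice_def
proof (intro allI impI)
  fix \<epsilon> :: real assume "\<epsilon> > 0"
  define c where "c = 1 / (b + \<kappa>)"
  have "c > 0" using assms by (simp add: c_def)
  define s where "s \<delta> = (\<epsilon> * \<delta>) powr c" for \<delta>
  show "\<exists>s C. (s \<longlongrightarrow> 0) (at_right 0) \<and> (\<forall>\<^sub>F \<delta> in at_right 0. 0 < s \<delta> \<and>
      s \<delta> powr b * s \<delta> powr \<kappa> \<le> \<epsilon> * \<delta> \<and> \<delta> / s \<delta> powr \<kappa> \<le> C * \<delta> powr (b / (b + \<kappa>)))"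
  proof (intro exI conjI)
    have "((\<lambda>\<delta>. \<epsilon> powr c * \<delta> powr c) \<longlongrightarrow> \<epsilon> powr c * 0) (at_right 0)"
      using \<open>c > 0\<close> by (intro tendsto_intros tendsto_powr_at_right_0)
    then show "(s \<longlongrightarrow> 0) (at_right 0)"
      using \<open>\<epsilon> > 0\<close> by (simp add: s_def[abs_def] powr_mult)
    show "\<forall>\<^sub>F \<delta> in at_right 0. 0 < s \<delta> \<and> s \<delta> powr b * s \<delta> powr \<kappa> \<le> \<epsilon> * \<delta> \<and>
        \<delta> / s \<delta> powr \<kappa> \<le> \<epsilon> powr (- c * \<kappa>) * \<delta> powr (b / (b + \<kappa>))"
      using eventually_at_right_less[of 0]
    proof eventually_elim
      case (elim \<delta>)
      have "s \<delta> powr b * s \<delta> powr \<kappa> = (\<epsilon> * \<delta>) powr (c * (b + \<kappa>))"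
        by (simp add: s_def powr_powr powr_add[symmetric] algebra_simps)
      also have "\<dots> = \<epsilon> * \<delta>" using assms elim \<open>\<epsilon> > 0\<close> by (simp add: c_def)
      finally have "s \<delta> powr b * s \<delta> powr \<kappa> = \<epsilon> * \<delta>" .
      moreover have "\<delta> / s \<delta> powr \<kappa> = \<epsilon> powr (- c * \<kappa>) * (\<delta> powr 1 * \<delta> powr (- c * \<kappa>))"
        using elim \<open>\<epsilon> > 0\<close> by (simp add: s_def powr_mult powr_powr powr_minus divide_inverse)
      moreover have "1 + (- c * \<kappa>) = b / (b + \<kappa>)"
        using assms by (simp add: c_def field_simps)
      ultimately show ?case
        using elim \<open>\<epsilon> > 0\<close> by (simp only: powr_add[symmetric]) (simp add: s_def)
    qed
  qed
qed

text \<open>Here \<open>s \<delta> powr \<kappa> = \<eta> * \<delta> * ln (1 / \<delta>) powr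
  \<mu>\<close> yields the rate directly. As \<open>\<kappa>\<close> lies below \<open>1\<close>,
  eventually \<open>s \<delta> \<le> \<delta>\<close>, and by monotonicity the value of the index
  function at \<open>\<delta>\<close> bounds that at \<open>s \<delta>\<close>;
  \<open>\<eta> = \<epsilon> / K\<close> cancels \<open>K\<close>.\<close>

lemma admits_parameter_choice_log:
  assumes "0 < \<kappa>" "\<kappa> < 1 / 2" "\<mu> > 0" "K > 0"
  shows "admits_parameter_choice \<kappa> (log_index K \<mu>) (\<lambda>\<delta>. ln (1 / \<delta>) powr (- \<mu>))"
  unfolding admits_parameter_choice_def
proof (intro allI impI)
  fix \<epsilon> :: real assume "\<epsilon> > 0"
  define \<eta> where "\<eta> = \<epsilon> / K"
  have "\<eta> > 0" using \<open>\<epsilon> > 0\<close> \<open>K > 0\<close> by (simp add: \<eta>_def)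
  define s where "s \<delta> = (\<eta> * \<delta> * ln (1 / \<delta>) powr \<mu>) powr (1 / \<kappa>)" for \<delta>
  have small: "\<forall>\<^sub>F \<delta> in at_right 0. \<eta> * \<delta> * ln (1 / \<delta>) powr \<mu> \<le> \<delta> powr \<kappa>"
    using assms \<open>\<eta> > 0\<close> by real_asymp
  have ev: "\<forall>\<^sub>F \<delta> in at_right 0. 0 < s \<delta> \<and> s \<delta> \<le> \<delta> \<and> log_index K \<mu> (s \<delta>) * s \<delta> powr \<kappa> \<le> \<epsilon> * \<delta> \<and>
      \<delta> / s \<delta> powr \<kappa> \<le> 1 / \<eta> * ln (1 / \<delta>) powr (- \<mu>)"
    using small eventually_at_right_real[of 0 "exp (- 1)", OF exp_gt_zero]
  proof eventually_elim
    case (elim \<delta>)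
    then have \<delta>: "0 < \<delta>" "\<delta> \<le> exp (- 1)" by auto
    define l where "l = ln (1 / \<delta>)"
    have "ln \<delta> \<le> ln (exp (- 1))" using \<delta> by (subst ln_le_cancel_iff) auto
    then have l: "l \<ge> 1" using \<delta> by (simp add: l_def ln_div)
    then have base: "\<eta> * \<delta> * l powr \<mu> > 0" using \<delta> \<open>\<eta> > 0\<close> by simp
    have s_pow: "s \<delta> powr \<kappa> = \<eta> * \<delta> * l powr \<mu>"
      using base \<open>\<kappa> > 0\<close> by (simp add: s_def powr_powr flip: l_def)
    have s_pos: "s \<delta> > 0" using \<delta> l \<open>\<eta> > 0\<close> by (simp add: s_def flip: l_def)
    have "s \<delta> \<le> (\<delta> powr \<kappa>) powr (1 / \<kappa>)"
      unfolding s_def using elim base \<open>\<kappa> > 0\<close> by (intro powr_mono2) (auto simp: l_def)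
    also have "\<dots> = \<delta>" using \<delta> \<open>\<kappa> > 0\<close> by (simp add: powr_powr)
    finally have s_le: "s \<delta> \<le> \<delta>" .
    have "log_index K \<mu> (s \<delta>) \<le> K * l powr (- \<mu>)"
      using log_index_mono[OF \<open>\<mu> > 0\<close> \<open>K > 0\<close> s_le] \<delta> by (simp add: log_index_def l_def)
    then have "log_index K \<mu> (s \<delta>) * s \<delta> powr \<kappa> \<le> (K * l powr (- \<mu>)) * s \<delta> powr \<kappa>"
      by (intro mult_right_mono) auto
    also have "\<dots> = \<epsilon> * \<delta>"
      using l \<open>K > 0\<close> by (simp add: s_pow \<eta>_def powr_minus field_simps)
    finally have "log_index K \<mu> (s \<delta>) * s \<delta> powr \<kappa> \<le> \<epsilon> * \<delta>" .
    moreover have "\<delta> / s \<delta> powr \<kappa> = 1 / \<eta> * l powr (- \<mu>)"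
      using \<delta> by (simp add: s_pow powr_minus divide_inverse)
    ultimately show ?case using s_pos s_le by (simp add: l_def)
  qed
  have "(s \<longlongrightarrow> 0) (at_right 0)"
    by (rule tendsto_sandwich[of "\<lambda>_. 0" s _ "\<lambda>\<delta>. \<delta>"])
      (use ev in \<open>auto elim: eventually_mono intro: tendsto_ident_at\<close>)
  with ev show "\<exists>s C. (s \<longlongrightarrow> 0) (at_right 0) \<and> (\<forall>\<^sub>F \<delta> in at_right 0. 0 < s \<delta> \<and>
      log_index K \<mu> (s \<delta>) * s \<delta> powr \<kappa> \<le> \<epsilon> * \<delta> \<and> \<delta> / s \<delta> powr \<kappa> \<le> C * ln (1 / \<delta>) powr (- \<mu>))"
    by (intro exI[of _ s] exI[of _ "1 / \<eta>"] conjI) (auto elim: eventually_mono)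
qed

section \<open>Convergence rates under source conditions\<close>

context bounded_below_self_adjoint
begin

text \<open>Common form of both source conditions: \<open>\<phi>\<close> is the source function in
  the spectral variable of the inverse of \<open>B\<close>, and \<open>\<rho>\<close> is an index
  function dominating it. For small \<open>\<alpha>\<close> the ball of radius
  \<open>\<rho> \<alpha> * norm w\<close> lies in \<open>DF\<close>, which makes the error bound
  available.\<close>

lemma balancing_source_rate:
  fixes F :: "'a \<Rightarrow> 'b::real_inner"
  assumes a: "a > 0" "ca > 0" "Ca > 0"
    and F: "\<And>x. x \<in> DF \<inter> D \<Longrightarrow>
      ca * neg_scale_norm D B a (x - xdag) \<le> norm (F x - F xdag) \<and>
      norm (F x - F xdag) \<le> Ca * neg_scale_norm D B a (x - xdag)"
    and "xbar \<in> D" and interior: "xdag \<in> interior DF"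
    and "\<eta> > 0"
    and data: "\<And>\<delta>. 0 < \<delta> \<Longrightarrow> \<delta> \<le> \<eta> \<Longrightarrow> norm (F xdag - yd \<delta>) \<le> \<delta>"
    and min: "\<And>\<delta> \<alpha>. 0 < \<delta> \<Longrightarrow> \<delta> \<le> \<eta> \<Longrightarrow> \<alpha> > 0 \<Longrightarrow>
      is_arg_min (tikhonov F B xbar (yd \<delta>) \<alpha>) (\<lambda>x. x \<in> DF \<inter> D) (xreg \<delta> \<alpha>)"
    and grid: "q > 1" "cl > 0" "cu > 0"
      "\<And>\<delta>. 0 < \<delta> \<Longrightarrow> \<delta> \<le> \<eta> \<Longrightarrow> 0 < \<alpha>0 \<delta> \<and> \<alpha>0 \<delta> \<le> cl * \<delta> powr (1 / kap a)"
      "\<And>\<delta>. 0 < \<delta> \<Longrightarrow> \<delta> \<le> \<eta> \<Longrightarrow> cu \<le> q ^ N \<delta> * \<alpha>0 \<delta>"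
    and \<tau>: "\<tau> > 1 + q powr (- kap a)"
    and source: "xdag - xbar = \<Phi> \<phi> w" and \<phi>: "continuous_on UNIV \<phi>"
    and \<rho>_nonneg: "\<And>\<alpha>. \<rho> \<alpha> \<ge> 0"
    and \<rho>_mono: "\<And>\<alpha> \<beta>. 0 < \<alpha> \<Longrightarrow> \<alpha> \<le> \<beta> \<Longrightarrow> \<rho> \<alpha> \<le> \<rho> \<beta>"
    and \<rho>_tendsto: "(\<rho> \<longlongrightarrow> 0) (at_right 0)"
    and "\<gamma> > 0"
    and index: "\<And>t \<alpha>. 0 < \<alpha> \<Longrightarrow> \<alpha> \<le> \<gamma> \<Longrightarrow>
      \<bar>\<phi> t\<bar> \<le> \<rho> \<alpha> * max 1 ((\<bar>t\<bar> powr (2 * a + 2) / \<alpha>) powr (1 / (2 * a + 2)))"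
    and choice: "admits_parameter_choice (kap a) \<rho> rate"
    and rate: "(rate \<longlongrightarrow> 0) (at_right 0)"
  shows "(\<lambda>\<delta>. norm (xreg \<delta> (balancing_param a ca \<tau> q (\<alpha>0 \<delta>) (N \<delta>) (xreg \<delta>) \<delta>) - xdag))
    \<in> O[at_right 0](rate)"
proof -
  obtain r where "r > 0" and r: "cball xdag r \<subseteq> DF"
    using interior by (auto simp: mem_interior_cball)
  have "((\<lambda>\<alpha>. \<rho> \<alpha> * norm w) \<longlongrightarrow> 0 * norm w) (at_right 0)"
    by (intro tendsto_intros \<rho>_tendsto)
  then have "\<forall>\<^sub>F \<alpha> in at_right 0. \<rho> \<alpha> * norm w < r"
    using \<open>r > 0\<close> by (intro order_tendstoD(2)) auto
  then obtain b where "b > 0" and b: "\<And>\<alpha>. 0 < \<alpha> \<Longrightarrow> \<alpha> < b \<Longrightarrow> \<rho> \<alpha> * norm w < r"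
    unfolding eventually_at_right_field by blast
  define E where "E = (max 1 (2 / ca) * tikhonov_const ca Ca + 1) * norm w"
  have "E \<ge> 0"
    using tikhonov_const_pos[OF a(2,3)] unfolding E_def
    by (intro mult_nonneg_nonneg add_nonneg_nonneg) auto
  \<comment> \<open>The bound at \<open>b\<close> is strict, so a closed range of parameters ends at
    \<open>b / 2\<close>.\<close>
  have "min \<gamma> (b / 2) > 0" using \<open>\<gamma> > 0\<close> \<open>b > 0\<close> by simp
  moreover have "norm (xreg \<delta> \<alpha> - xdag) \<le> \<delta> / lam a ca \<alpha> + E * \<rho> \<alpha>"
    if \<delta>: "0 < \<delta>" "\<delta> \<le> \<eta>" and \<alpha>: "0 < \<alpha>" "\<alpha> \<le> min \<gamma> (b / 2)" for \<delta> \<alpha>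
  proof -
    have "\<alpha> \<le> \<gamma>" "\<alpha> < b" using \<alpha> \<open>b > 0\<close> by auto
    have "cball xdag (\<rho> \<alpha> * norm w) \<subseteq> DF"
      using b[OF \<open>0 < \<alpha>\<close> \<open>\<alpha> < b\<close>] r by (meson less_imp_le order_trans subset_cball)
    then have "norm (xreg \<delta> \<alpha> - xdag) \<le> \<delta> / lam a ca \<alpha>
        + (max 1 (2 / ca) * tikhonov_const ca Ca + 1) * (\<rho> \<alpha> * norm w)"
      using \<delta> by (intro tikhonov_rate[OF a \<open>0 < \<alpha>\<close> _ F data \<open>xbar \<in> D\<close> min source \<phi> \<rho>_nonneg
            index[OF \<open>0 < \<alpha>\<close> \<open>\<alpha> \<le> \<gamma>\<close>]] \<open>0 < \<alpha>\<close>) auto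
    then show ?thesis by (simp add: E_def mult_ac)
  qed
  ultimately show ?thesis
    by (intro balancing_rate[OF a(1) grid(1) \<tau> \<open>\<eta> > 0\<close> grid(2,3) \<open>E \<ge> 0\<close> _ grid(4,5) _ \<rho>_mono choice rate])
qed

end

theorem corollary2:
  fixes F :: "'a::{real_inner, complete_space, second_countable_topology} \<Rightarrow>
              'b::{real_inner, complete_space, second_countable_topology}"
    and DF DB :: "'a set"
    and B :: "'a \<Rightarrow> 'a"
    and xdag xbar :: 'a
    and y :: 'b
    and a ca Ca m \<delta>0 q c5 c6 c7 \<tau>L :: real
    and yd :: "real \<Rightarrow> 'b"
    and xreg :: "real \<Rightarrow> real \<Rightarrow> 'a"
    and \<alpha>0 :: "real \<Rightarrow> real"
    and N :: "real \<Rightarrow> nat"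
  assumes "infinite_dimensional TYPE('a)" and "infinite_dimensional TYPE('b)"
    and "convex DF" and "closed DF" and "weakly_seq_continuous_on DF F"
    and "self_adjoint DB B" and "unbounded_operator DB B"
    and "m > 0" and "\<And>x. x \<in> DB \<Longrightarrow> norm (B x) \<ge> m * norm x"
    and "xbar \<in> DF \<inter> DB"
    and "xdag \<in> interior DF" and "y = F xdag"
    and "a > 0" and "0 < ca" and "ca \<le> Ca"
    and "\<And>x. x \<in> DF \<inter> DB \<Longrightarrow>
           ca * neg_scale_norm DB B a (x - xdag) \<le> norm (F x - F xdag) \<and>
           norm (F x - F xdag) \<le> Ca * neg_scale_norm DB B a (x - xdag)"
    and "\<delta>0 > 0"
    and "\<And>\<delta>. 0 < \<delta> \<Longrightarrow> \<delta> \<le> \<delta>0 \<Longrightarrow> norm (y - yd \<delta>) \<le> \<delta>"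
    and "\<And>\<delta> \<alpha>. 0 < \<delta> \<Longrightarrow> \<delta> \<le> \<delta>0 \<Longrightarrow> \<alpha> > 0 \<Longrightarrow>
           is_arg_min (tikhonov F B xbar (yd \<delta>) \<alpha>) (\<lambda>x. x \<in> DF \<inter> DB) (xreg \<delta> \<alpha>)"
    and "q > 1" and "c5 > 0" and "c6 > 0" and "c7 > 0"
    and "\<And>\<delta>. 0 < \<delta> \<Longrightarrow> \<delta> \<le> \<delta>0 \<Longrightarrow> 0 < \<alpha>0 \<delta> \<and> \<alpha>0 \<delta> \<le> c5 * \<delta> powr (1 / kap a)"
    and "\<And>\<delta>. 0 < \<delta> \<Longrightarrow> \<delta> \<le> \<delta>0 \<Longrightarrow> c6 \<le> q ^ N \<delta> * \<alpha>0 \<delta> \<and> q ^ N \<delta> * \<alpha>0 \<delta> \<le> c7"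
    and "\<tau>L > 1 + q powr (- kap a)"
  defines "\<alpha>star \<equiv> \<lambda>\<delta>. balancing_param a ca \<tau>L q (\<alpha>0 \<delta>) (N \<delta>) (xreg \<delta>) \<delta>"
  shows "(\<forall>p w. 0 < p \<and> p \<le> 1 \<and> xdag - xbar = neg_power DB B p w \<longrightarrow>
            (\<lambda>\<delta>. norm (xreg \<delta> (\<alpha>star \<delta>) - xdag)) \<in> O[at_right 0](\<lambda>\<delta>. \<delta> powr (p / (a + p)))) \<and>
         (\<forall>\<mu> K w. \<mu> > 0 \<and> K > 0 \<and>
            xdag - xbar = spectral_calculus (log_index K \<mu>) (neg_power DB B (2 * a + 2)) w \<longrightarrow>
            (\<lambda>\<delta>. norm (xreg \<delta> (\<alpha>star \<delta>) - xdag)) \<in> O[at_right 0](\<lambda>\<delta>. ln (1 / \<delta>) powr (- \<mu>)))"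
proof -
  interpret bounded_below_self_adjoint DB B m
    using assms by unfold_locales auto
  have k: "0 < kap a" "kap a < 1 / 2" using \<open>a > 0\<close> by (simp_all add: kap_def field_simps)
  have a2: "2 * a + 2 > 0" using \<open>a > 0\<close> by simp
  note rate = balancing_source_rate[where a = a and ca = ca and Ca = Ca and DF = DF and F = F
      and xdag = xdag and xbar = xbar and yd = yd and xreg = xreg and q = q and N = N
      and \<eta> = \<delta>0 and cl = c5 and cu = c6]
  show ?thesis
  proof (intro conjI allI impI; elim conjE)
    fix p w assume p: "0 < p" "p \<le> 1" and source: "xdag - xbar = neg_power DB B p w"
    \<comment> \<open>\<open>\<bar>t\<bar> powr p\<close> is the power \<open>b\<close> of the
      spectral variable of \<open>G\<close>, so the index function is
      \<open>\<alpha> powr b\<close>.\<close>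
    define b where "b = p / (2 * a + 2)"
    have "b > 0" using p a2 by (simp add: b_def)
    have exponent: "b / (b + kap a) = p / (a + p)"
    proof -
      have "b + kap a = (a + p) / (2 * a + 2)" by (simp add: b_def kap_def add_divide_distrib)
      then show ?thesis using a2 by (simp add: b_def)
    qed
    have index: "\<bar>\<bar>t\<bar> powr p\<bar> \<le> \<alpha> powr b * max 1 ((\<bar>t\<bar> powr (2 * a + 2) / \<alpha>) powr (1 / (2 * a + 2)))"
      if "0 < \<alpha>" for t \<alpha> :: real
    proof -
      define s where "s = \<bar>t\<bar> powr (2 * a + 2) / \<alpha>"
      have "s \<ge> 0" using \<open>0 < \<alpha>\<close> by (simp add: s_def)
      have "\<bar>t\<bar> powr p = (\<alpha> * s) powr b"
        using \<open>0 < \<alpha>\<close> a2 by (simp add: s_def powr_powr b_def)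
      also have "\<dots> = \<alpha> powr b * s powr b"
        using \<open>0 < \<alpha>\<close> \<open>s \<ge> 0\<close> by (simp add: powr_mult)
      also have "s powr b \<le> max 1 (s powr (1 / (2 * a + 2)))"
      proof (cases "s \<le> 1")
        case True
        then have "s powr b \<le> 1" using \<open>s \<ge> 0\<close> \<open>b > 0\<close> by (intro powr_le1) auto
        then show ?thesis by simp
      next
        case False
        then have "s powr b \<le> s powr (1 / (2 * a + 2))"
          using p a2 unfolding b_def by (intro powr_mono divide_right_mono) auto
        then show ?thesis by simp
      qed
      finally show ?thesis by (simp add: s_def mult_left_mono)
    qed
    show "(\<lambda>\<delta>. norm (xreg \<delta> (\<alpha>star \<delta>) - xdag)) \<in> O[at_right 0](\<lambda>\<delta>. \<delta> powr (p / (a + p)))"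
      unfolding \<alpha>star_def
    proof (rule rate[where \<rho> = "\<lambda>\<alpha>. \<alpha> powr b" and \<gamma> = 1 and w = w])
      show "xdag - xbar = \<Phi> (\<lambda>t. \<bar>t\<bar> powr p) w"
        using source by (simp add: neg_power_def)
      show "admits_parameter_choice (kap a) (\<lambda>\<alpha>. \<alpha> powr b) (\<lambda>\<delta>. \<delta> powr (p / (a + p)))"
        using admits_parameter_choice_power[OF k(1) \<open>b > 0\<close>] by (simp add: exponent)
      show "((\<lambda>\<delta>. \<delta> powr (p / (a + p))) \<longlongrightarrow> 0) (at_right 0)"
        using p \<open>a > 0\<close> by (intro tendsto_powr_at_right_0) simp
    qed (use assms p \<open>b > 0\<close> index in
        \<open>auto intro: continuous_on_abs_powr tendsto_powr_at_right_0 powr_mono2\<close>)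
  next
    fix \<mu> K w assume "\<mu> > 0" "K > 0"
      and source: "xdag - xbar = spectral_calculus (log_index K \<mu>) (neg_power DB B (2 * a + 2)) w"
    let ?b = "1 / (2 * a + 2)"
    \<comment> \<open>\<open>G\<close> is itself a function of the inverse of \<open>B\<close>; the
      composition rule makes the logarithmic function of \<open>G\<close> this function of that
      inverse.\<close>
    let ?\<phi> = "\<lambda>t. log_index K \<mu> (\<bar>t\<bar> powr (2 * a + 2))"
    \<comment> \<open>The first argument of the dominating function in \<open>log_index_le\<close>
      for the exponent \<open>?b\<close>.\<close>
    define C where "C = (1 + \<mu> / ?b) powr \<mu> * K"
    have "1 + \<mu> / ?b > 0" using \<open>\<mu> > 0\<close> \<open>a > 0\<close> by (intro add_pos_pos divide_pos_pos) auto
    then have "C > 0" unfolding C_def using \<open>K > 0\<close> by simp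
    have pc: "continuous_on S (\<lambda>t::real. \<bar>t\<bar> powr (2 * a + 2))" for S
      using continuous_on_abs_powr[OF a2] .
    show "(\<lambda>\<delta>. norm (xreg \<delta> (\<alpha>star \<delta>) - xdag)) \<in> O[at_right 0](\<lambda>\<delta>. ln (1 / \<delta>) powr - \<mu>)"
      unfolding \<alpha>star_def
    proof (rule rate[where \<rho> = "log_index C \<mu>" and \<gamma> = "exp (- 1)" and w = w])
      show "xdag - xbar = \<Phi> ?\<phi> w"
        unfolding source neg_power_def
        by (rule spectral_calculus_compose[OF pc continuous_log_index[OF \<open>\<mu> > 0\<close>]])
      show "continuous_on UNIV ?\<phi>"
        using continuous_on_compose2[OF continuous_log_index[OF \<open>\<mu> > 0\<close>] pc] by simp
      show "\<bar>?\<phi> t\<bar> \<le> log_index C \<mu> \<alpha> * max 1 ((\<bar>t\<bar> powr (2 * a + 2) / \<alpha>) powr ?b)"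
        if "0 < \<alpha>" "\<alpha> \<le> exp (- 1)" for t \<alpha>
        unfolding C_def abs_of_nonneg[OF log_index_nonneg[OF \<open>K > 0\<close>]]
        using \<open>a > 0\<close> by (intro log_index_le \<open>\<mu> > 0\<close> \<open>K > 0\<close> that) simp
    qed (use assms \<open>\<mu> > 0\<close> \<open>C > 0\<close> k in \<open>auto intro: log_index_nonneg log_index_mono
        tendsto_log_index tendsto_log_powr_at_right_0 admits_parameter_choice_log\<close>)
  qed
qed

end
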